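(* Let $b\ge 0$ be an integer and let $\mathcal{F}$ be a family of graphs such that $box(G')\le b$ for every $G'\in\mathcal{F}$. Let $T(n)$ denote the time required to compute a $b$-dimensional box representation of a graph belonging to $\mathcal{F}$ on $n$ vertices. Let $G$ be an $\mathcal{F}+kv$ graph on $n$ vertices. Then, given a modulator of $G$ (a set $S\subseteq V(G)$ with $|S|\le k$ and $G\setminus S\in\mathcal{F}$), a box representation $\mathcal{B}$ of $G$ with $|\mathcal{B}|\le box(G)\left(2+\frac{b}{box(G)}\right)$ can be computed in time $T(n-k)+n^2\,2^{O(k^2\log k)}$.
   Context: All graphs are finite and simple. A graph is an interval graph if one can assign to each vertex a closed interval of $\mathbb{R}$ such that two distinct vertices are adjacent iff their intervals intersect. For a graph $G(V,E)$, a box representation of $G$ of dimension $k$ is a collection $\mathcal{B}=\{I_1,\dots,I_k\}$ of interval graphs on vertex set $V$ with $E(G)=E(I_1)\cap\cdots\cap E(I_k)$; $|\mathcal{B}|$ denotes its dimension $k$. The boxicity $box(G)$ of an incomplete graph $G$ is the minimum $k$ such that $G$ has a box representation of dimension $k$; for a complete graph it is $0$. For a family $\mathcal{F}$ of graphs and an integer $k\ge 0$, $\mathcal{F}+kv$ is the family of graphs $G$ that can be converted into a graph in $\mathcal{F}$ by deleting at most $k$ vertices; a set $S\subseteq V(G)$ with $|S|\le k$ and $G\setminus S\in\mathcal{F}$ is called a modulator of $G$.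
   Formalization: For complete G (box(G)=0, where b/box(G) is undefined) the bound is read as b; the term T(n-k) is read as T(n-|S|), the same when |S|=k (T(n-k) may be undefined when |S|<k); G has at least one vertex. *)

theory Defs
  imports Complex_Main "HOL-Library.Landau_Symbols"
begin

record 'a sgraph =
  verts :: "'a set"
  edges :: "'a set set"

definition vertex_pairs :: "'a set \<Rightarrow> 'a set set" where
  "vertex_pairs V = {{u, v} |u v. u \<in> V \<and> v \<in> V \<and> u \<noteq> v}"

definition simple_graph :: "'a sgraph \<Rightarrow> bool" where
  "simple_graph G \<longleftrightarrow> finite (verts G) \<and> edges G \<subseteq> vertex_pairs (verts G)"

definition complete_graph :: "'a sgraph \<Rightarrow> bool" where
  "complete_graph G \<longleftrightarrow> simple_graph G \<and> edges G = vertex_pairs (verts G)"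

definition delete_verts :: "'a sgraph \<Rightarrow> 'a set \<Rightarrow> 'a sgraph" where
  "delete_verts G S = \<lparr>verts = verts G - S, edges = {e \<in> edges G. e \<inter> S = {}}\<rparr>"

definition interval_graph :: "'a sgraph \<Rightarrow> bool" where
  "interval_graph G \<longleftrightarrow> simple_graph G \<and>
     (\<exists>l r :: 'a \<Rightarrow> real. (\<forall>v \<in> verts G. l v \<le> r v) \<and>
       (\<forall>u \<in> verts G. \<forall>v \<in> verts G. u \<noteq> v \<longrightarrow>
          ({u, v} \<in> edges G \<longleftrightarrow> {l u..r u} \<inter> {l v..r v} \<noteq> {})))"

text \<open>The dimension of a box representation is the length of the list. The intersection is taken
  inside the set of all vertex pairs, so that the empty list represents exactly the
  complete graphs.\<close>

definition box_representation :: "'a sgraph \<Rightarrow> 'a sgraph list \<Rightarrow> bool" where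
  "box_representation G Is \<longleftrightarrow>
     (\<forall>I \<in> set Is. interval_graph I \<and> verts I = verts G) \<and>
     edges G = vertex_pairs (verts G) \<inter> (\<Inter>I \<in> set Is. edges I)"

definition boxicity :: "'a sgraph \<Rightarrow> nat" where
  "boxicity G = (if complete_graph G then 0
     else LEAST k. \<exists>Is. box_representation G Is \<and> length Is = k)"

definition modulator :: "'a sgraph set \<Rightarrow> nat \<Rightarrow> 'a sgraph \<Rightarrow> 'a set \<Rightarrow> bool" where
  "modulator F k G S \<longleftrightarrow> S \<subseteq> verts G \<and> card S \<le> k \<and> delete_verts G S \<in> F"

definition plus_kv :: "'a sgraph set \<Rightarrow> nat \<Rightarrow> 'a sgraph set" where
  "plus_kv F k = {G. simple_graph G \<and> (\<exists>S. modulator F k G S)}"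

text \<open>The machine model is a structured random access machine with uniform cost: a store of
  natural-number arrays with indirect addressing, of which a program mentions only finitely many;
  the operations are addition and truncated subtraction, a guard holds if its value is nonzero.
  Every evaluated expression node and every executed assignment or test costs one unit.
  Multiplication is deliberately absent, since at unit cost on unbounded numbers it would make the
  machine unrealistically powerful.\<close>

type_synonym store = "nat \<Rightarrow> nat \<Rightarrow> nat"

datatype expr = Lit nat | Cell nat expr | Plus expr expr | Minus expr expr

fun eval_expr :: "expr \<Rightarrow> store \<Rightarrow> nat" where
  "eval_expr (Lit n) s = n"
| "eval_expr (Cell a e) s = s a (eval_expr e s)"
| "eval_expr (Plus e f) s = eval_expr e s + eval_expr f s"
| "eval_expr (Minus e f) s = eval_expr e s - eval_expr f s"

fun expr_cost :: "expr \<Rightarrow> nat" where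
  "expr_cost (Lit n) = 1"
| "expr_cost (Cell a e) = 1 + expr_cost e"
| "expr_cost (Plus e f) = 1 + expr_cost e + expr_cost f"
| "expr_cost (Minus e f) = 1 + expr_cost e + expr_cost f"

datatype prog =
    Assign nat expr expr
  | Seq prog prog
  | If expr prog prog
  | While expr prog

inductive exec :: "prog \<Rightarrow> store \<Rightarrow> nat \<Rightarrow> store \<Rightarrow> bool" where
  Assign: "exec (Assign a e f) s (1 + expr_cost e + expr_cost f)
             (s(a := (s a)(eval_expr e s := eval_expr f s)))"
| Seq: "exec p s t s' \<Longrightarrow> exec q s' u s'' \<Longrightarrow> exec (Seq p q) s (t + u) s''"
| IfTrue: "eval_expr e s \<noteq> 0 \<Longrightarrow> exec p s t s' \<Longrightarrow> exec (If e p q) s (1 + expr_cost e + t) s'"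
| IfFalse: "eval_expr e s = 0 \<Longrightarrow> exec q s t s' \<Longrightarrow> exec (If e p q) s (1 + expr_cost e + t) s'"
| WhileFalse: "eval_expr e s = 0 \<Longrightarrow> exec (While e p) s (1 + expr_cost e) s"
| WhileTrue: "eval_expr e s \<noteq> 0 \<Longrightarrow> exec p s t s' \<Longrightarrow> exec (While e p) s' u s'' \<Longrightarrow>
             exec (While e p) s (1 + expr_cost e + t + u) s''"

text \<open>Input is read from array 0, everything else being initially 0; output is left in an
  initial segment of array 1.\<close>

definition init_store :: "nat list \<Rightarrow> store" where
  "init_store xs = (\<lambda>a i. if a = 0 \<and> i < length xs then xs ! i else 0)"

definition runs :: "prog \<Rightarrow> nat list \<Rightarrow> nat \<Rightarrow> nat list \<Rightarrow> bool" where
  "runs p xs t ys \<longleftrightarrow>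
     (\<exists>s. exec p (init_store xs) t s \<and> (\<forall>i < length ys. s 1 i = ys ! i))"

text \<open>Graphs are given to and returned by programs as adjacency matrices, relative to an
  enumeration of the vertices. Programs have to cope with every enumeration, so
  a family of graphs need not be assumed closed under isomorphism.\<close>

definition enumerates :: "'a list \<Rightarrow> 'a set \<Rightarrow> bool" where
  "enumerates vs V \<longleftrightarrow> distinct vs \<and> set vs = V"

definition adj_matrix :: "'a list \<Rightarrow> 'a sgraph \<Rightarrow> nat list" where
  "adj_matrix vs G = concat (map (\<lambda>u. map (\<lambda>v. of_bool ({u, v} \<in> edges G)) vs) vs)"

definition graph_code :: "'a list \<Rightarrow> 'a sgraph \<Rightarrow> nat list" where
  "graph_code vs G = length vs # adj_matrix vs G"

definition graph_set_code :: "'a list \<Rightarrow> 'a sgraph \<Rightarrow> 'a set \<Rightarrow> nat list" where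
  "graph_set_code vs G S = graph_code vs G @ map (\<lambda>v. of_bool (v \<in> S)) vs"

definition rep_code :: "'a list \<Rightarrow> 'a sgraph list \<Rightarrow> nat list" where
  "rep_code vs Is = length Is # concat (map (adj_matrix vs) Is)"

definition computes_box_reps :: "prog \<Rightarrow> 'a sgraph set \<Rightarrow> nat \<Rightarrow> (nat \<Rightarrow> nat) \<Rightarrow> bool" where
  "computes_box_reps p F b T \<longleftrightarrow>
     (\<forall>G \<in> F. \<forall>vs. enumerates vs (verts G) \<longrightarrow>
        (\<exists>Is t. box_representation G Is \<and> length Is = b \<and>
           runs p (graph_code vs G) t (rep_code vs Is) \<and> t \<le> T (card (verts G))))"

end

theory Submission
  imports Defs "HOL-Real_Asymp.Real_Asymp"
begin

text \<open>Let \<open>S\<close> be the modulator. The \<open>b\<close> interval graphs representing \<open>G \ S\<close> extend to \<open>G\<close> by making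
  the vertices of \<open>S\<close> universal, and they take care of all nonedges outside \<open>S\<close>. The nonedges meeting
  \<open>S\<close> have to be covered by at most \<open>2 box(G)\<close> further interval graphs in which the vertices outside
  \<open>S\<close> form a clique; these exist because every interval graph of an optimal representation can be
  replaced by two, in which the intervals outside \<open>S\<close> are stretched to the far left and to the far right.

  In an interval graph of this kind the intervals outside \<open>S\<close> share a point, and one may shrink each
  of them to the least interval containing that point and reaching all neighbours in \<open>S\<close>. So the graph is
  determined by the order of that point and the \<open>2|S|\<close> endpoints of the intervals of \<open>S\<close>, which
  leaves \<open>2 ^ O(k log k)\<close> candidates. As \<open>|S|\<close> such graphs always suffice, trying all tuples
  of candidates in the order of their length takes \<open>n\<^sup>2 2 ^ O(k\<^sup>2 log k)\<close> steps.\<close>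

section \<open>Reasoning about programs\<close>

text \<open>The search never learns \<open>boxicity G\<close>. It climbs through the dimensions and
  stops at the first success, so it suffices that a covering digit string exists in some dimension
  bounded both by \<open>2 * boxicity G\<close>, for the size of the output, and by the size s of
  \<open>S\<close>, for the running time. A dimension takes 2s+1 digits below 2s+1, whence the
  exponent k^2 log k. No digit string has to be rejected as malformed: the hulls of arbitrary digits
  meet across every edge, so only the separation of nonedges is tested. The program for
  \<open>F\<close> is arbitrary and specified on initial stores only. It must therefore find array 0
  holding exactly the code of \<open>G\<close> without \<open>S\<close>, and its other arrays empty;
  renaming its arrays costs nothing, so its time enters unchanged. As the machine cannot multiply,
  products and matrix positions are carried along by addition, which explains the many running
  counters.\<close>

fun writes :: "prog \<Rightarrow> nat set" where
  "writes (Assign a e f) = {a}"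
| "writes (Seq p q) = writes p \<union> writes q"
| "writes (If e p q) = writes p \<union> writes q"
| "writes (While e p) = writes p"

lemma exec_frame: "exec p s t s' \<Longrightarrow> a \<notin> writes p \<Longrightarrow> s' a = s a"
  by (induction rule: exec.induct) auto

fun straight :: "prog \<Rightarrow> bool" where
  "straight (Assign a e f) = True"
| "straight (Seq p q) = (straight p \<and> straight q)"
| "straight (If e p q) = (straight p \<and> straight q)"
| "straight (While e p) = False"

text \<open>Loop-free code acts as a function that the simplifier can evaluate. The clause for
  \<open>While\<close> is a placeholder excluded by \<open>straight\<close>.\<close>

fun straight_run :: "prog \<Rightarrow> store \<Rightarrow> store" where
  "straight_run (Assign a e f) s = s(a := (s a)(eval_expr e s := eval_expr f s))"
| "straight_run (Seq p q) s = straight_run q (straight_run p s)"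
| "straight_run (If e p q) s = (if eval_expr e s \<noteq> 0 then straight_run p s else straight_run q s)"
| "straight_run (While e p) s = s"

text \<open>Charging the dearer branch of a conditional gives a bound that depends on the program
  text alone.\<close>

fun straight_cost :: "prog \<Rightarrow> nat" where
  "straight_cost (Assign a e f) = 1 + expr_cost e + expr_cost f"
| "straight_cost (Seq p q) = straight_cost p + straight_cost q"
| "straight_cost (If e p q) = 1 + expr_cost e + max (straight_cost p) (straight_cost q)"
| "straight_cost (While e p) = 0"

text \<open>Total correctness with a time budget: \<open>exec\<close> is inductive and so contains
  terminating runs only. The budget is an upper bound, which lets estimates be rounded
  anywhere.\<close>

definition reaches :: "prog \<Rightarrow> store \<Rightarrow> nat \<Rightarrow> (store \<Rightarrow> bool) \<Rightarrow> bool" where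
  "reaches p s t Q \<longleftrightarrow> (\<exists>s' u. exec p s u s' \<and> u \<le> t \<and> Q s')"

lemma reachesI: "exec p s u s' \<Longrightarrow> u \<le> t \<Longrightarrow> Q s' \<Longrightarrow> reaches p s t Q"
  by (auto simp: reaches_def)

lemma reachesE:
  assumes "reaches p s t Q"
  obtains s' u where "exec p s u s'" "u \<le> t" "Q s'"
  using assms by (auto simp: reaches_def)

lemma reaches_mono:
  "reaches p s t Q \<Longrightarrow> t \<le> t' \<Longrightarrow> (\<And>s'. Q s' \<Longrightarrow> Q' s') \<Longrightarrow> reaches p s t' Q'"
  unfolding reaches_def by (meson order_trans)

text \<open>Framing by whole arrays keeps everything that a subprogram leaves alone out of the
  postconditions and invariants.\<close>

lemma reaches_frame:
  "reaches p s t Q \<Longrightarrow> reaches p s t (\<lambda>s'. Q s' \<and> (\<forall>x. x \<notin> writes p \<longrightarrow> s' x = s x))"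
  unfolding reaches_def by (metis exec_frame)

lemma reaches_Seq:
  assumes "reaches p s t Q" "\<And>s'. Q s' \<Longrightarrow> reaches q s' t' R"
  shows "reaches (Seq p q) s (t + t') R"
proof -
  obtain s1 u1 where 1: "exec p s u1 s1" "u1 \<le> t" "Q s1"
    using assms(1) by (rule reachesE)
  obtain s2 u2 where 2: "exec q s1 u2 s2" "u2 \<le> t'" "R s2"
    using assms(2)[OF 1(3)] by (rule reachesE)
  show ?thesis
    using reachesI[OF exec.Seq[OF 1(1) 2(1)]] 1 2 by auto
qed

lemma reaches_Seq_frame:
  assumes "reaches p s t Q"
    and "\<And>s'. Q s' \<Longrightarrow> (\<And>x. x \<notin> writes p \<Longrightarrow> s' x = s x) \<Longrightarrow> reaches q s' t' R"
  shows "reaches (Seq p q) s (t + t') R"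
  by (rule reaches_Seq[OF reaches_frame[OF assms(1)]]) (use assms(2) in blast)

lemma straight_exec:
  "straight p \<Longrightarrow> \<exists>u \<le> straight_cost p. exec p s u (straight_run p s)"
proof (induction p arbitrary: s)
  case (Assign a e f)
  show ?case
    unfolding straight_run.simps straight_cost.simps using exec.Assign[of a e f s] by blast
next
  case (Seq p q)
  obtain u where u: "u \<le> straight_cost p" "exec p s u (straight_run p s)"
    using Seq by auto
  obtain v where v: "v \<le> straight_cost q"
    "exec q (straight_run p s) v (straight_run q (straight_run p s))"
    using Seq by auto
  show ?case
    using exec.Seq[OF u(2) v(2)] u(1) v(1) by (auto intro!: exI[of _ "u + v"])
next
  case (If e p q)
  show ?case
  proof (cases "eval_expr e s = 0")
    case True
    obtain u where u: "u \<le> straight_cost q" "exec q s u (straight_run q s)"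
      using If by auto
    show ?thesis
      using exec.IfFalse[OF True u(2)] u(1) True by (auto intro!: exI[of _ "Suc (expr_cost e + u)"])
  next
    case False
    obtain u where u: "u \<le> straight_cost p" "exec p s u (straight_run p s)"
      using If by auto
    show ?thesis
      using exec.IfTrue[OF False u(2)] u(1) False by (auto intro!: exI[of _ "Suc (expr_cost e + u)"])
  qed
qed auto

lemma reaches_straight:
  "straight p \<Longrightarrow> straight_cost p \<le> t \<Longrightarrow> Q (straight_run p s) \<Longrightarrow> reaches p s t Q"
  using straight_exec[of p s] by (meson order_trans reachesI)

abbreviation Var :: "nat \<Rightarrow> expr" where "Var a \<equiv> Cell a (Lit 0)"
abbreviation Set :: "nat \<Rightarrow> expr \<Rightarrow> prog" where "Set a e \<equiv> Assign a (Lit 0) e"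
abbreviation Inc :: "nat \<Rightarrow> prog" where "Inc a \<equiv> Set a (Plus (Var a) (Lit 1))"

section \<open>Counting loops and their cost\<close>

definition For :: "nat \<Rightarrow> nat \<Rightarrow> prog \<Rightarrow> prog" where
  "For i a p = Seq (Set i (Lit 0)) (While (Minus (Var a) (Var i)) (Seq p (Inc i)))"

lemma writes_For [simp]: "writes (For i a p) = insert i (writes p)"
  by (auto simp: For_def)

text \<open>Induction on the number of iterations left. The invariant has to be insensitive to the
  counter array (\<open>indep\<close>) because the loop itself overwrites it. Each iteration pays 12
  for guard and increment, 6 each; the 9 is 3 for the initialisation and 6 for the final
  guard.\<close>

lemma For_rule:
  assumes fresh: "i \<notin> writes p" "a \<noteq> i" "a \<notin> writes p"
    and N: "s0 a 0 = N"
    and init: "I 0 s0"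
    and indep: "\<And>j s x. I j s \<Longrightarrow> I j (s(i := x))"
    and step: "\<And>j s. j < N \<Longrightarrow> (\<And>x. x \<noteq> i \<Longrightarrow> x \<notin> writes p \<Longrightarrow> s x = s0 x) \<Longrightarrow>
      s i 0 = j \<Longrightarrow> I j s \<Longrightarrow> reaches p s t (I (Suc j))"
  shows "reaches (For i a p) s0 (N * (t + 12) + 9) (I N)"
proof -
  let ?W = "While (Minus (Var a) (Var i)) (Seq p (Inc i))"
  have loop: "reaches ?W s ((N - j) * (t + 12) + 6) (I N)"
    if "j \<le> N" "\<And>x. x \<noteq> i \<Longrightarrow> x \<notin> writes p \<Longrightarrow> s x = s0 x" "s i 0 = j" "I j s" for j s
    using that
  proof (induction "N - j" arbitrary: j s)
    case 0
    then have "j = N" by simp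
    have "exec ?W s (1 + expr_cost (Minus (Var a) (Var i))) s"
      by (rule exec.WhileFalse) (use 0 \<open>j = N\<close> fresh N in auto)
    then show ?case
      by (rule reachesI) (use 0 \<open>j = N\<close> in auto)
  next
    case (Suc m)
    then have "j < N" by simp
    obtain s1 u1 where 1: "exec p s u1 s1" "u1 \<le> t" "I (Suc j) s1"
      using step[OF \<open>j < N\<close> Suc.prems(2,3,4)] by (rule reachesE) auto
    let ?s = "s1(i := (s1 i)(0 := Suc j))"
    have i1: "s1 i 0 = j"
      using exec_frame[OF 1(1) fresh(1)] Suc.prems by simp
    have inc: "exec (Inc i) s1 6 ?s"
      using exec.Assign[of i "Lit 0" "Plus (Var i) (Lit 1)" s1] i1 by (simp add: numeral_eq_Suc)
    have "reaches ?W ?s ((N - Suc j) * (t + 12) + 6) (I N)"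
    proof (rule Suc.hyps(1))
      show "?s x = s0 x" if "x \<noteq> i" "x \<notin> writes p" for x
        using exec_frame[OF 1(1) that(2)] Suc.prems(2)[OF that] that by simp
    qed (use Suc.hyps \<open>j < N\<close> 1 indep in auto)
    then obtain s2 u2 where 2: "exec ?W ?s u2 s2" "u2 \<le> (N - Suc j) * (t + 12) + 6" "I N s2"
      by (rule reachesE)
    have "exec ?W s (1 + expr_cost (Minus (Var a) (Var i)) + (u1 + 6) + u2) s2"
      by (rule exec.WhileTrue[OF _ exec.Seq[OF 1(1) inc] 2(1)])
        (use Suc.prems fresh N \<open>j < N\<close> in auto)
    moreover have "N - j = Suc (N - Suc j)" using \<open>j < N\<close> by simp
    ultimately show ?case
      using 1 2 by (intro reachesI) auto
  qed
  have "reaches (Set i (Lit 0)) s0 3 (\<lambda>s. s = s0(i := (s0 i)(0 := 0)))"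
    by (rule reaches_straight) auto
  then have "reaches (For i a p) s0 (3 + ((N - 0) * (t + 12) + 6)) (I N)"
    unfolding For_def by (rule reaches_Seq) (rule loop, use init indep in auto)
  then show ?thesis
    by (rule reaches_mono) auto
qed

text \<open>\<open>w\<close> tracks the row-major index of the current pair by counting, since it
  cannot be computed by multiplication.\<close>

definition For2 :: "nat \<Rightarrow> nat \<Rightarrow> nat \<Rightarrow> nat \<Rightarrow> prog \<Rightarrow> prog" where
  "For2 i j w a p = Seq (Set w (Lit 0)) (For i a (For j a (Seq p (Inc w))))"

lemma writes_For2 [simp]: "writes (For2 i j w a p) = {i, j, w} \<union> writes p"
  by (auto simp: For2_def)

text \<open>Both loops share one invariant indexed by the row-major position, which a complete inner
  loop advances by \<open>N\<close>. The 51 consists of 18 for the inner bookkeeping and 33 that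
  absorb the linear and constant terms, using \<open>N \<ge> 1\<close>.\<close>

lemma For2_rule:
  assumes fresh: "distinct [i, j, w, a]" "i \<notin> writes p" "j \<notin> writes p" "w \<notin> writes p" "a \<notin> writes p"
    and N: "s0 a 0 = N" "N \<ge> 1"
    and init: "I 0 s0"
    and indep: "\<And>m s x. I m s \<Longrightarrow> I m (s(i := x))" "\<And>m s x. I m s \<Longrightarrow> I m (s(j := x))"
      "\<And>m s x. I m s \<Longrightarrow> I m (s(w := x))"
    and step: "\<And>u v s. u < N \<Longrightarrow> v < N \<Longrightarrow>
      (\<And>x. x \<noteq> i \<Longrightarrow> x \<noteq> j \<Longrightarrow> x \<noteq> w \<Longrightarrow> x \<notin> writes p \<Longrightarrow> s x = s0 x) \<Longrightarrow>
      s i 0 = u \<Longrightarrow> s j 0 = v \<Longrightarrow> s w 0 = u * N + v \<Longrightarrow> I (u * N + v) s \<Longrightarrow>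
      reaches p s t (I (Suc (u * N + v)))"
  shows "reaches (For2 i j w a p) s0 (N * N * (t + 51)) (I (N * N))"
proof -
  let ?J = "\<lambda>m s. I m s \<and> s w 0 = m"
  let ?in = "For j a (Seq p (Inc w))"
  have body: "reaches (Seq p (Inc w)) s (t + 6) (?J (Suc (u * N + v)))"
    if uv: "u < N" "v < N" and fr: "\<And>x. x \<noteq> i \<Longrightarrow> x \<noteq> j \<Longrightarrow> x \<noteq> w \<Longrightarrow> x \<notin> writes p \<Longrightarrow> s x = s0 x"
      and s: "s i 0 = u" "s j 0 = v" and J: "?J (u * N + v) s" for u v s
  proof -
    have "reaches p s t (I (Suc (u * N + v)))"
      by (rule step[OF uv fr]) (use s J in auto)
    then show ?thesis
      by (rule reaches_Seq_frame)
        (rule reaches_straight, use J fresh indep in auto)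
  qed
  have inner: "reaches ?in s (N * (t + 6 + 12) + 9) (?J (Suc u * N))"
    if u: "u < N" and fr: "\<And>x. x \<noteq> i \<Longrightarrow> x \<noteq> j \<Longrightarrow> x \<noteq> w \<Longrightarrow> x \<notin> writes p \<Longrightarrow> s x = s0 x"
      and s: "s i 0 = u" and J: "?J (u * N) s" for u s
  proof -
    have "reaches ?in s (N * (t + 6 + 12) + 9) (?J (u * N + N))"
    proof (rule For_rule[where I = "\<lambda>k. ?J (u * N + k)"])
      show "s a 0 = N" using fr fresh N by auto
      show "?J (u * N + 0) s" using J by simp
      fix k s' assume k: "k < N" "\<And>x. x \<noteq> j \<Longrightarrow> x \<notin> writes (Seq p (Inc w)) \<Longrightarrow> s' x = s x"
        "s' j 0 = k" "?J (u * N + k) s'"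
      show "reaches (Seq p (Inc w)) s' (t + 6) (?J (u * N + Suc k))"
        using body[OF u k(1), of s'] k fr s fresh by auto
    qed (use fresh indep in auto)
    then show ?thesis by (simp add: add.commute)
  qed
  have "reaches (Set w (Lit 0)) s0 3 (\<lambda>s. s = s0(w := (s0 w)(0 := 0)))"
    by (rule reaches_straight) auto
  then have "reaches (For2 i j w a p) s0 (3 + (N * (N * (t + 6 + 12) + 9 + 12) + 9)) (?J (N * N))"
    unfolding For2_def
  proof (rule reaches_Seq)
    fix s assume s: "s = s0(w := (s0 w)(0 := 0))"
    show "reaches (For i a ?in) s (N * (N * (t + 6 + 12) + 9 + 12) + 9) (?J (N * N))"
    proof (rule For_rule[where I = "\<lambda>u. ?J (u * N)"])
      fix u s' assume k: "u < N" "\<And>x. x \<noteq> i \<Longrightarrow> x \<notin> writes ?in \<Longrightarrow> s' x = s x"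
        "s' i 0 = u" "?J (u * N) s'"
      show "reaches ?in s' (N * (t + 6 + 12) + 9) (?J (Suc u * N))"
        by (rule inner[OF k(1)]) (use k s in auto)
    qed (use fresh indep N s init in auto)
  qed
  moreover have "3 + (N * (N * (t + 6 + 12) + 9 + 12) + 9) \<le> N * N * (t + 51)"
  proof -
    have "N \<le> N * N" "1 \<le> N * N" using N(2) by auto
    then have "21 * N + 12 \<le> 33 * (N * N)" by linarith
    then show ?thesis by (simp add: algebra_simps)
  qed
  ultimately show ?thesis
    by (rule reaches_mono) auto
qed

section \<open>Renaming arrays\<close>

fun rename_expr :: "(nat \<Rightarrow> nat) \<Rightarrow> expr \<Rightarrow> expr" where
  "rename_expr f (Lit n) = Lit n"
| "rename_expr f (Cell a e) = Cell (f a) (rename_expr f e)"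
| "rename_expr f (Plus d e) = Plus (rename_expr f d) (rename_expr f e)"
| "rename_expr f (Minus d e) = Minus (rename_expr f d) (rename_expr f e)"

fun rename :: "(nat \<Rightarrow> nat) \<Rightarrow> prog \<Rightarrow> prog" where
  "rename f (Assign a d e) = Assign (f a) (rename_expr f d) (rename_expr f e)"
| "rename f (Seq p q) = Seq (rename f p) (rename f q)"
| "rename f (If e p q) = If (rename_expr f e) (rename f p) (rename f q)"
| "rename f (While e p) = While (rename_expr f e) (rename f p)"

lemma rename_expr_cost [simp]: "expr_cost (rename_expr f e) = expr_cost e"
  by (induction e) auto

lemma eval_rename_expr:
  "(\<And>a. r (f a) = s a) \<Longrightarrow> eval_expr (rename_expr f e) r = eval_expr e s"
  by (induction e) auto

text \<open>By injectivity an update of \<open>f a\<close> does not show at any other renamed array,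
  so both runs proceed in lockstep. Arrays outside the range of \<open>f\<close> may hold anything,
  which is what lets a foreign program run beside other data.\<close>

lemma exec_rename:
  assumes "exec p s t s'" "inj f" "\<And>a. r (f a) = s a"
  shows "\<exists>r'. exec (rename f p) r t r' \<and> (\<forall>a. r' (f a) = s' a)"
  using assms
proof (induction arbitrary: r rule: exec.induct)
  case (Assign a d e s)
  let ?r = "r(f a := (r (f a))(eval_expr d s := eval_expr e s))"
  have "exec (rename f (Assign a d e)) r (1 + expr_cost d + expr_cost e) ?r"
    using exec.Assign[of "f a" "rename_expr f d" "rename_expr f e" r]
      eval_rename_expr[of r f s, OF Assign(2)] by simp
  moreover have "?r (f x) = (s(a := (s a)(eval_expr d s := eval_expr e s))) x" for x
    using Assign by (auto simp: inj_eq)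
  ultimately show ?case by blast
next
  case (Seq p s t s' q u s'')
  obtain r1 where 1: "exec (rename f p) r t r1" "\<And>a. r1 (f a) = s' a"
    using Seq by metis
  obtain r2 where 2: "exec (rename f q) r1 u r2" "\<And>a. r2 (f a) = s'' a"
    using Seq 1 by metis
  show ?case using exec.Seq[OF 1(1) 2(1)] 2(2) by auto
next
  case (IfTrue e s p t s' q)
  obtain r1 where 1: "exec (rename f p) r t r1" "\<And>a. r1 (f a) = s' a"
    using IfTrue by metis
  have "eval_expr (rename_expr f e) r \<noteq> 0"
    using IfTrue eval_rename_expr by metis
  from exec.IfTrue[OF this 1(1)] 1(2) show ?case by auto
next
  case (IfFalse e s q t s' p)
  obtain r1 where 1: "exec (rename f q) r t r1" "\<And>a. r1 (f a) = s' a"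
    using IfFalse by metis
  have "eval_expr (rename_expr f e) r = 0"
    using IfFalse eval_rename_expr by metis
  from exec.IfFalse[OF this 1(1)] 1(2) show ?case by auto
next
  case (WhileFalse e s p)
  have "eval_expr (rename_expr f e) r = 0"
    using WhileFalse eval_rename_expr by metis
  from exec.WhileFalse[OF this, of "rename f p"] WhileFalse show ?case by auto
next
  case (WhileTrue e s p t s' u s'')
  obtain r1 where 1: "exec (rename f p) r t r1" "\<And>a. r1 (f a) = s' a"
    using WhileTrue by metis
  obtain r2 where 2: "exec (rename f (While e p)) r1 u r2" "\<And>a. r2 (f a) = s'' a"
    using WhileTrue 1 by metis
  have "eval_expr (rename_expr f e) r \<noteq> 0"
    using WhileTrue eval_rename_expr by metis
  from exec.WhileTrue[OF this 1(1)] 2 show ?case by auto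
qed

lemma writes_rename: "writes (rename f p) \<subseteq> range f"
  by (induction p) auto

section \<open>Interval graphs given by digits\<close>

text \<open>The rank of \<open>v\<close> among the marked numbers. It numbers the modulator vertices
  from 0 and thereby gives them digit addresses; \<open>rk M n\<close> is the size of the
  modulator.\<close>

definition rk :: "(nat \<Rightarrow> bool) \<Rightarrow> nat \<Rightarrow> nat" where
  "rk M v = card {u. u < v \<and> M u}"

lemma rk_0 [simp]: "rk M 0 = 0"
  by (simp add: rk_def)

lemma rk_Suc: "rk M (Suc v) = rk M v + of_bool (M v)"
proof -
  have "{u. u < Suc v \<and> M u} = (if M v then insert v {u. u < v \<and> M u} else {u. u < v \<and> M u})"
    by (auto simp: less_Suc_eq)
  then show ?thesis by (simp add: rk_def)
qed

lemma rk_mono: "u \<le> v \<Longrightarrow> rk M u \<le> rk M v"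
  unfolding rk_def by (rule card_mono) auto

lemma rk_less: "u < v \<Longrightarrow> M u \<Longrightarrow> rk M u < rk M v"
  using rk_mono[of "Suc u" v M] by (simp add: rk_Suc)

lemma inj_on_rk: "inj_on (rk M) {v. M v}"
proof (rule inj_onI)
  fix u v assume "u \<in> {v. M v}" "v \<in> {v. M v}" "rk M u = rk M v"
  then show "u = v" using rk_less[of u v M] rk_less[of v u M] by (cases u v rule: linorder_cases) auto
qed

text \<open>Pigeonhole: ranks are injective on the marked numbers below \<open>n\<close>, and there
  are as many of these as possible values.\<close>

lemma rk_surj:
  assumes "k < rk M n"
  shows "\<exists>v<n. M v \<and> rk M v = k"
proof -
  let ?S = "{u. u < n \<and> M u}"
  have "card (rk M ` ?S) = rk M n"
    using inj_on_rk[of M] by (subst card_image) (auto simp: rk_def[of M n] intro: inj_on_subset)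
  moreover have "rk M ` ?S \<subseteq> {..<rk M n}"
    by (auto simp: rk_less)
  ultimately have "rk M ` ?S = {..<rk M n}"
    by (intro card_subset_eq) auto
  then have "k \<in> rk M ` ?S" using assms by simp
  then show ?thesis by auto
qed

locale masked_graph =
  fixes n :: nat and A :: "nat \<Rightarrow> nat \<Rightarrow> bool" and M :: "nat \<Rightarrow> bool"
begin

text \<open>Vertices are numbers below \<open>n\<close>, and \<open>M\<close> marks the modulator. Dimension \<open>i\<close> is described by the
  \<open>i\<close>-th block of \<open>base\<close> digits: the common point of the unmasked vertices, followed by the two endpoints
  of each masked vertex. Taking hulls turns arbitrary digits into intervals that meet wherever they have
  to, even if they encode a left endpoint exceeding the right one.\<close>

definition base :: nat where "base = 2 * rk M n + 1"

definition lo :: "(nat \<Rightarrow> nat) \<Rightarrow> nat \<Rightarrow> nat \<Rightarrow> nat" where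
  "lo X i v = X (i * base + (if M v then 2 * rk M v + 1 else 0))"

definition hi :: "(nat \<Rightarrow> nat) \<Rightarrow> nat \<Rightarrow> nat \<Rightarrow> nat" where
  "hi X i v = X (i * base + (if M v then 2 * rk M v + 2 else 0))"

text \<open>To reach the interval of \<open>u\<close>, a left endpoint only has to get down to the
  right endpoint of \<open>u\<close>, hence the minimum over right endpoints. The case
  \<open>u = v\<close> keeps a marked interval nonempty when its two digits come in the wrong
  order.\<close>

definition hull_lo :: "(nat \<Rightarrow> nat) \<Rightarrow> nat \<Rightarrow> nat \<Rightarrow> nat" where
  "hull_lo X i v = Min (insert (lo X i v) (hi X i ` {u. u < n \<and> M u \<and> (A u v \<or> u = v)}))"

definition hull_hi :: "(nat \<Rightarrow> nat) \<Rightarrow> nat \<Rightarrow> nat \<Rightarrow> nat" where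
  "hull_hi X i v = Max (insert (hi X i v) (lo X i ` {u. u < n \<and> M u \<and> (A u v \<or> u = v)}))"

definition meets :: "(nat \<Rightarrow> nat) \<Rightarrow> nat \<Rightarrow> nat \<Rightarrow> nat \<Rightarrow> bool" where
  "meets X i u v \<longleftrightarrow> hull_lo X i u \<le> hull_hi X i v \<and> hull_lo X i v \<le> hull_hi X i u"

text \<open>The pairs that the digits need not separate. Nonedges between unmarked vertices are
  among them because the given representation takes care of those.\<close>

definition exempt :: "nat \<Rightarrow> nat \<Rightarrow> bool" where
  "exempt u v \<longleftrightarrow> A u v \<or> u = v \<or> (\<not> M u \<and> \<not> M v)"

text \<open>The converse, that exempt pairs meet in every dimension, holds for all digit strings and
  is therefore not part of the test.\<close>

definition covers :: "nat \<Rightarrow> (nat \<Rightarrow> nat) \<Rightarrow> bool" where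
  "covers d X \<longleftrightarrow> (\<forall>u<n. \<forall>v<n. exempt u v \<or> (\<exists>i<d. \<not> meets X i u v))"

lemma meets_sym: "meets X i u v \<longleftrightarrow> meets X i v u"
  by (auto simp: meets_def)

lemma hull_lo_le_lo: "hull_lo X i v \<le> lo X i v"
  by (simp add: hull_lo_def)

lemma hull_lo_le_hi: "u < n \<Longrightarrow> M u \<Longrightarrow> A u v \<or> u = v \<Longrightarrow> hull_lo X i v \<le> hi X i u"
  unfolding hull_lo_def by (rule Min_le) auto

lemma hull_hi_ge_hi: "hi X i v \<le> hull_hi X i v"
  by (simp add: hull_hi_def)

lemma hull_hi_ge_lo: "u < n \<Longrightarrow> M u \<Longrightarrow> A u v \<or> u = v \<Longrightarrow> lo X i u \<le> hull_hi X i v"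
  unfolding hull_hi_def by (rule Max_ge) auto

lemma hull_lo_le_hull_hi: "v < n \<Longrightarrow> hull_lo X i v \<le> hull_hi X i v"
proof (cases "M v")
  case True
  then show "v < n \<Longrightarrow> ?thesis"
    using hull_lo_le_hi[of v v X i] hull_hi_ge_hi[of X i v] by simp
next
  case False
  then have "lo X i v = hi X i v" by (simp add: lo_def hi_def)
  then show ?thesis
    using hull_lo_le_lo[of X i v] hull_hi_ge_hi[of X i v] by simp
qed

text \<open>A marked vertex draws the hull of each neighbour as far as its own interval; unmarked
  hulls share the common point; a vertex meets itself because hulls are nonempty.\<close>

lemma exempt_meets:
  assumes "exempt u v" "u < n" "v < n" and sym: "\<And>u v. A u v \<Longrightarrow> A v u"
  shows "meets X i u v"
proof -
  have masked: "meets X i u v" if "u < n" "M u" "A u v" for u v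
    using that hull_lo_le_hi[of u v X i] hull_hi_ge_hi[of X i u] hull_lo_le_lo[of X i u]
      hull_hi_ge_lo[of u v X i] by (simp add: meets_def)
  have unmasked: "meets X i u v" if "\<not> M u" "\<not> M v" for u v
  proof -
    have "lo X i u = X (i * base)" "hi X i u = X (i * base)"
      "lo X i v = X (i * base)" "hi X i v = X (i * base)"
      using that by (auto simp: lo_def hi_def)
    then show ?thesis
      using hull_lo_le_lo[of X i u] hull_hi_ge_hi[of X i u] hull_lo_le_lo[of X i v]
        hull_hi_ge_hi[of X i v] by (simp add: meets_def)
  qed
  show ?thesis
  proof (cases "M u \<or> M v")
    case True
    then show ?thesis
      using masked[of u v] masked[of v u] assms meets_sym[of X i u v] hull_lo_le_hull_hi[of u X i]
      by (auto simp: exempt_def meets_def)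
  qed (use unmasked in auto)
qed

text \<open>The positions of the endpoints only matter up to order, and an interval of an unmasked vertex
  only matters through the common point and the masked neighbours that it has to reach.\<close>

lemma exists_digits:
  fixes c :: "nat \<Rightarrow> real" and l r :: "nat \<Rightarrow> nat \<Rightarrow> real"
  assumes lr: "\<And>i v. i < d \<Longrightarrow> v < n \<Longrightarrow> l i v \<le> r i v"
    and adj: "\<And>i u v. i < d \<Longrightarrow> u < n \<Longrightarrow> v < n \<Longrightarrow> A u v \<Longrightarrow> l i u \<le> r i v \<and> l i v \<le> r i u"
    and common: "\<And>i v. i < d \<Longrightarrow> v < n \<Longrightarrow> \<not> M v \<Longrightarrow> l i v \<le> c i \<and> c i \<le> r i v"
    and cover: "\<And>u v. u < n \<Longrightarrow> v < n \<Longrightarrow> \<not> exempt u v \<Longrightarrow> \<exists>i<d. r i u < l i v \<or> r i v < l i u"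
  shows "\<exists>X. (\<forall>j. X j < base) \<and> (\<forall>j \<ge> d * base. X j = 0) \<and> covers d X"
proof -
  define S where "S = {u. u < n \<and> M u}"
  define E where "E i = insert (c i) (l i ` S \<union> r i ` S)" for i
  \<comment> \<open>Coordinates become ranks among the relevant endpoints. This preserves the strict
    order on \<open>E i\<close> and brings its members below \<open>base\<close>, as
    \<open>E i\<close> has at most 2|S|+1 elements.\<close>
  define \<phi> where "\<phi> i x = card {e \<in> E i. e < x}" for i x
  have S: "finite S" "card S = rk M n" by (auto simp: S_def rk_def)
  have finE: "finite (E i)" for i by (simp add: E_def S)
  have cardE: "card (E i) \<le> base" for i
  proof -
    have "card (E i) \<le> Suc (card (l i ` S \<union> r i ` S))"
      unfolding E_def by (rule card_insert_le_m1) auto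
    also have "card (l i ` S \<union> r i ` S) \<le> card (l i ` S) + card (r i ` S)"
      by (rule card_Un_le)
    also have "\<dots> \<le> card S + card S"
      using S card_image_le by (meson add_mono)
    finally show ?thesis by (simp add: base_def S)
  qed
  have \<phi>_mono: "\<phi> i x \<le> \<phi> i y" if "x \<le> y" for i x y
    unfolding \<phi>_def by (rule card_mono) (use finE that in auto)
  have \<phi>_strict: "\<phi> i x < \<phi> i y" if "x < y" "x \<in> E i" for i x y
    unfolding \<phi>_def by (rule psubset_card_mono) (use finE that in auto)
  have \<phi>_base: "\<phi> i x < base" if "x \<in> E i" for i x
  proof -
    have "\<phi> i x < card (E i)"
      unfolding \<phi>_def by (rule psubset_card_mono) (use finE that in auto)
    then show ?thesis using cardE[of i] by simp
  qed
  define idx where "idx k = inv_into S (rk M) k" for k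
  have idx: "idx (rk M v) = v" if "v \<in> S" for v
    unfolding idx_def
    by (rule inv_into_f_f) (use that inj_on_rk[of M] in \<open>auto simp: S_def intro: inj_on_subset\<close>)
  \<comment> \<open>Inverts the addressing in \<open>lo\<close> and \<open>hi\<close>: offset 0 is
    the common point, odd offsets are left and even ones right endpoints. The zeros after the last
    block make the string unique for its digits, as the enumeration requires.\<close>
  define X where "X j = (if j < d * base then (let i = j div base; t = j mod base in
      if t = 0 then \<phi> i (c i) else if odd t then \<phi> i (l i (idx ((t - 1) div 2)))
      else \<phi> i (r i (idx ((t - 2) div 2)))) else 0)" for j
  have rkS: "2 * rk M v + 2 < base" if "v \<in> S" for v
    using that rk_less[of v n M] by (auto simp: S_def base_def)
  have X_at: "X (i * base + t) = (if t = 0 then \<phi> i (c i) else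
      if odd t then \<phi> i (l i (idx ((t - 1) div 2))) else \<phi> i (r i (idx ((t - 2) div 2))))"
    if "i < d" "t < base" for i t
  proof -
    have "i * base + t < Suc i * base" using that by simp
    also have "\<dots> \<le> d * base" using that by (intro mult_right_mono) auto
    finally show ?thesis using that by (simp add: X_def Let_def)
  qed
  have base_pos: "0 < base" by (simp add: base_def)
  have lo_S: "lo X i v = \<phi> i (l i v)" and hi_S: "hi X i v = \<phi> i (r i v)"
    if "i < d" "v \<in> S" for i v
    using that rkS[of v] X_at[of i "2 * rk M v + 1"] X_at[of i "2 * rk M v + 2"] idx[of v]
    by (auto simp: lo_def hi_def S_def)
  have lo_c: "lo X i v = \<phi> i (c i)" and hi_c: "hi X i v = \<phi> i (c i)"
    if "i < d" "\<not> M v" for i v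
    using that X_at[of i 0] base_pos by (auto simp: lo_def hi_def)
  have X_base: "X j < base" for j
  proof (cases "j < d * base")
    case True
    define i t where "i = j div base" and "t = j mod base"
    have j: "j = i * base + t" unfolding i_def t_def by (rule div_mult_mod_eq[symmetric])
    have t: "t < base" using base_pos by (simp add: t_def)
    have i: "i < d" using True base_pos by (simp add: i_def less_mult_imp_div_less)
    have in_S: "idx k \<in> S" if "k < rk M n" for k using rk_surj[OF that] idx by (auto simp: S_def)
    have "(t - 1) div 2 < rk M n" "(t - 2) div 2 < rk M n" if "t \<noteq> 0"
      using t that by (auto simp: base_def)
    then show ?thesis
      unfolding j X_at[OF i t] using in_S by (auto intro!: \<phi>_base simp: E_def)
  next
    case False
    then show ?thesis by (simp add: X_def base_pos)
  qed
  \<comment> \<open>Hulls do not bridge a real gap: every point whose rank enters the upper end for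
    \<open>v\<close> is at most \<open>r i v\<close>, every one for the lower end of
    \<open>u\<close> is at least \<open>l i u\<close>, and all of them lie in \<open>E i\<close>,
    where ranks are strictly monotone.\<close>
  have sep: "hull_hi X i v < hull_lo X i u"
    if i: "i < d" and uv: "u < n" "v < n" and rl: "r i v < l i u" for i u v
  proof -
    define x where "x = (if M v then r i v else c i)"
    define y where "y = (if M u then l i u else c i)"
    have hv: "hi X i v = \<phi> i x" using hi_S[OF i] hi_c[OF i] uv by (auto simp: x_def S_def)
    have lu: "lo X i u = \<phi> i y" using lo_S[OF i] lo_c[OF i] uv by (auto simp: y_def S_def)
    have x: "x \<le> r i v" "x \<in> E i" and y: "l i u \<le> y" "y \<in> E i"
      using common[OF i] uv by (auto simp: x_def y_def E_def S_def)
    let ?P = "insert x (l i ` {w. w < n \<and> M w \<and> (A w v \<or> w = v)})"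
    let ?Q = "insert y (r i ` {w. w < n \<and> M w \<and> (A w u \<or> w = u)})"
    have P: "p \<le> r i v \<and> p \<in> E i" if "p \<in> ?P" for p
      using that x adj[OF i _ uv(2)] lr[OF i uv(2)] by (auto simp: E_def S_def)
    have Q: "l i u \<le> q \<and> q \<in> E i" if "q \<in> ?Q" for q
      using that y adj[OF i _ uv(1)] lr[OF i uv(1)] by (auto simp: E_def S_def)
    have hl: "hull_hi X i v = Max (\<phi> i ` ?P)"
      unfolding hull_hi_def hv image_insert image_image
      by (intro arg_cong[where f = Max] arg_cong2[where f = insert] image_cong refl)
        (use lo_S[OF i] in \<open>auto simp: S_def\<close>)
    have ll: "hull_lo X i u = Min (\<phi> i ` ?Q)"
      unfolding hull_lo_def lu image_insert image_image
      by (intro arg_cong[where f = Min] arg_cong2[where f = insert] image_cong refl)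
        (use hi_S[OF i] in \<open>auto simp: S_def\<close>)
    have "Max (\<phi> i ` ?P) \<in> \<phi> i ` ?P" by (rule Max_in) auto
    then obtain p where p: "p \<in> ?P" "Max (\<phi> i ` ?P) = \<phi> i p" by blast
    have "Min (\<phi> i ` ?Q) \<in> \<phi> i ` ?Q" by (rule Min_in) auto
    then obtain q where q: "q \<in> ?Q" "Min (\<phi> i ` ?Q) = \<phi> i q" by blast
    have "p < q" using P[OF p(1)] Q[OF q(1)] rl by linarith
    then show ?thesis unfolding hl ll p(2) q(2) using \<phi>_strict P[OF p(1)] by blast
  qed
  have "covers d X"
    unfolding covers_def
  proof (intro allI impI)
    fix u v assume uv: "u < n" "v < n"
    show "exempt u v \<or> (\<exists>i<d. \<not> meets X i u v)"
    proof (cases "exempt u v")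
      case False
      from cover[OF uv False] obtain i where i: "i < d" "r i u < l i v \<or> r i v < l i u" by blast
      then have "\<not> meets X i u v"
        using sep[OF i(1) uv(2,1)] sep[OF i(1) uv] by (auto simp: meets_def)
      then show ?thesis using i(1) by blast
    qed simp
  qed
  then show ?thesis using X_base by (intro exI[of _ X]) (auto simp: X_def)
qed

end

section \<open>Box representations from digits\<close>

context masked_graph
begin

text \<open>One dimension per modulator vertex \<open>w\<close>: it gets [0,0], its neighbours [0,1]
  and all others [1,1]. The vertices outside the modulator share the point 1, and every nonedge at
  \<open>w\<close> is separated.\<close>

lemma covers_masked:
  assumes sym: "\<And>u v. A u v \<Longrightarrow> A v u"
  shows "\<exists>X. (\<forall>j. X j < base) \<and> (\<forall>j \<ge> rk M n * base. X j = 0) \<and> covers (rk M n) X"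
proof -
  define w where "w k = (SOME v. v < n \<and> M v \<and> rk M v = k)" for k
  have w: "w k < n" "M (w k)" "rk M (w k) = k" if "k < rk M n" for k
    using someI_ex[OF rk_surj[OF that]] by (auto simp: w_def)
  have w_rk: "w (rk M v) = v" if "v < n" "M v" for v
    using w[of "rk M v"] that rk_less[of v n M] inj_on_rk[of M] by (auto simp: inj_on_def)
  define l where "l i v = (if v = w i \<or> A v (w i) then 0 else 1 :: real)" for i v
  define r where "r i v = (if v = w i then 0 else 1 :: real)" for i v
  show ?thesis
  proof (rule exists_digits[where l = l and r = r and c = "\<lambda>_. 1"])
    fix i u v assume "i < rk M n" "u < n" "v < n" "A u v"
    then show "l i u \<le> r i v \<and> l i v \<le> r i u"
      using sym by (auto simp: l_def r_def)
  next
    fix u v assume uv: "u < n" "v < n" "\<not> exempt u v"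
    have at: "rk M x < rk M n \<and> r (rk M x) x < l (rk M x) y"
      if "x < n" "M x" "y \<noteq> x" "\<not> A y x" for x y
      using that w_rk[of x] rk_less[of x n M] by (simp add: l_def r_def)
    have "M u \<or> M v" "u \<noteq> v" "\<not> A u v" "\<not> A v u" using uv sym by (auto simp: exempt_def)
    then show "\<exists>i<rk M n. r i u < l i v \<or> r i v < l i u"
      using at[of u v] at[of v u] uv(1,2) by blast
  qed (use w in \<open>auto simp: l_def r_def\<close>)
qed

text \<open>Copy \<open>2 * i\<close> stretches the unmarked intervals of dimension \<open>i\<close>
  to the left, copy \<open>2 * i + 1\<close> to the right; the common points are the two extremes.
  Stretching spoils separations on one side only, and a nonexempt pair has a marked vertex, so one
  of the copies preserves its separation.\<close>

lemma covers_double: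
  fixes l r :: "nat \<Rightarrow> nat \<Rightarrow> real"
  assumes lr: "\<And>i v. i < d \<Longrightarrow> v < n \<Longrightarrow> l i v \<le> r i v"
    and adj: "\<And>i u v. i < d \<Longrightarrow> u < n \<Longrightarrow> v < n \<Longrightarrow> A u v \<Longrightarrow> l i u \<le> r i v \<and> l i v \<le> r i u"
    and cover: "\<And>u v. u < n \<Longrightarrow> v < n \<Longrightarrow> \<not> exempt u v \<Longrightarrow> \<exists>i<d. r i u < l i v \<or> r i v < l i u"
  shows "\<exists>X. (\<forall>j. X j < base) \<and> (\<forall>j \<ge> 2 * d * base. X j = 0) \<and> covers (2 * d) X"
proof -
  \<comment> \<open>Dominates all endpoints in absolute value, so both \<open>c\<close> and
    \<open>- c\<close> are far enough out.\<close>
  define c where "c i = (\<Sum>v<n. \<bar>l i v\<bar> + \<bar>r i v\<bar>)" for i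
  have c: "\<bar>l i v\<bar> + \<bar>r i v\<bar> \<le> c i" if "v < n" for i v
    unfolding c_def by (rule member_le_sum) (use that in auto)
  define l' where "l' j v = (if even j \<and> \<not> M v then - c (j div 2) else l (j div 2) v)" for j v
  define r' where "r' j v = (if odd j \<and> \<not> M v then c (j div 2) else r (j div 2) v)" for j v
  define c' where "c' j = (if even j then - c (j div 2) else c (j div 2))" for j
  have l': "l' j v \<le> l (j div 2) v" and r': "r (j div 2) v \<le> r' j v" if "v < n" for j v
    using c[OF that, of "j div 2"] by (auto simp: l'_def r'_def)
  show ?thesis
  proof (rule exists_digits[where l = l' and r = r' and c = c'])
    fix i v assume "i < 2 * d" "v < n"
    then show "l' i v \<le> r' i v"
      using l'[of v i] r'[of v i] lr[of "i div 2" v] by linarith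
  next
    fix i u v assume a: "i < 2 * d" "u < n" "v < n" "A u v"
    then have "i div 2 < d" by auto
    from adj[OF this a(2-4)] show "l' i u \<le> r' i v \<and> l' i v \<le> r' i u"
      using l'[of u i] r'[of u i] l'[of v i] r'[of v i] a by linarith
  next
    fix i v assume "i < 2 * d" "v < n" "\<not> M v"
    then show "l' i v \<le> c' i \<and> c' i \<le> r' i v"
      using c[of v "i div 2"] by (auto simp: l'_def r'_def c'_def)
  next
    fix u v assume uv: "u < n" "v < n" "\<not> exempt u v"
    then have m: "M u \<or> M v" by (auto simp: exempt_def)
    \<comment> \<open>If the right-hand vertex \<open>v\<close> is marked, stretching to the left
      moves neither its left endpoint nor any right endpoint. Otherwise \<open>u\<close> is marked,
      and the copy stretched to the right serves.\<close>
    have half: "\<exists>j<2 * d. r' j u < l' j v" if "i < d" "r i u < l i v" "M u \<or> M v" for i u v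
    proof (cases "M v")
      case True
      then have "r' (2 * i) u < l' (2 * i) v" using that by (simp add: l'_def r'_def)
      then show ?thesis using that(1) by (intro exI[of _ "2 * i"]) auto
    next
      case False
      then have "r' (2 * i + 1) u < l' (2 * i + 1) v" using that by (simp add: l'_def r'_def)
      then show ?thesis using that(1) by (intro exI[of _ "2 * i + 1"]) auto
    qed
    obtain i where "i < d" "r i u < l i v \<or> r i v < l i u" using cover[OF uv] by blast
    then show "\<exists>i<2 * d. r' i u < l' i v \<or> r' i v < l' i u"
      using half[of i u v] half[of i v u] m by blast
  qed
qed

end

section \<open>Interval graphs with added universal vertices\<close>

lemma intervals_meet_iff:
  fixes a b c d :: real
  assumes "a \<le> b" "c \<le> d"
  shows "{a..b} \<inter> {c..d} \<noteq> {} \<longleftrightarrow> a \<le> d \<and> c \<le> b"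
  using assms by (simp add: Int_atLeastAtMost max_def min_def)

definition extend_graph :: "'a set \<Rightarrow> 'a set \<Rightarrow> 'a sgraph \<Rightarrow> 'a sgraph" where
  "extend_graph V S I =
     \<lparr>verts = V, edges = edges I \<union> {e \<in> vertex_pairs V. e \<inter> S \<noteq> {}}\<rparr>"

lemma verts_extend_graph [simp]: "verts (extend_graph V S I) = V"
  by (simp add: extend_graph_def)

lemma vertex_pairs_iff: "{u, v} \<in> vertex_pairs V \<longleftrightarrow> u \<in> V \<and> v \<in> V \<and> u \<noteq> v"
  by (auto simp: vertex_pairs_def doubleton_eq_iff)

lemma vertex_pairs_cases:
  assumes "e \<in> vertex_pairs V"
  obtains u v where "e = {u, v}" "u \<in> V" "v \<in> V" "u \<noteq> v"
  using assms by (auto simp: vertex_pairs_def)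

text \<open>The added vertices receive [-c, c] with \<open>c\<close> at least every endpoint in
  absolute value, and the remaining intervals are kept.\<close>

lemma interval_graph_extend:
  assumes I: "interval_graph I" "verts I = V - S" and V: "finite V"
  shows "interval_graph (extend_graph V S I)"
proof -
  obtain l r :: "'a \<Rightarrow> real" where lr: "\<And>v. v \<in> V - S \<Longrightarrow> l v \<le> r v"
    and e: "\<And>u v. u \<in> V - S \<Longrightarrow> v \<in> V - S \<Longrightarrow> u \<noteq> v \<Longrightarrow>
      {u, v} \<in> edges I \<longleftrightarrow> {l u..r u} \<inter> {l v..r v} \<noteq> {}"
    using I unfolding interval_graph_def by metis
  have sub: "edges I \<subseteq> vertex_pairs (V - S)"
    using I by (auto simp: interval_graph_def simple_graph_def)
  define c where "c = (\<Sum>v\<in>V. \<bar>l v\<bar> + \<bar>r v\<bar>)"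
  have c: "\<bar>l v\<bar> + \<bar>r v\<bar> \<le> c" if "v \<in> V" for v
    unfolding c_def by (rule member_le_sum) (use that V in auto)
  define l' where "l' v = (if v \<in> S then - c else l v)" for v
  define r' where "r' v = (if v \<in> S then c else r v)" for v
  have c0: "0 \<le> c" unfolding c_def by (intro sum_nonneg) auto
  have lr': "l' v \<le> r' v" if "v \<in> V" for v
    using that lr[of v] c0 by (auto simp: l'_def r'_def)
  have "{u, v} \<in> edges (extend_graph V S I) \<longleftrightarrow> {l' u..r' u} \<inter> {l' v..r' v} \<noteq> {}"
    if uv: "u \<in> V" "v \<in> V" "u \<noteq> v" for u v
  proof (cases "u \<in> S \<or> v \<in> S")
    case True
    then have "{u, v} \<in> edges (extend_graph V S I)"
      using uv by (auto simp: extend_graph_def vertex_pairs_iff)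
    moreover have "{l' u..r' u} \<inter> {l' v..r' v} \<noteq> {}"
      unfolding intervals_meet_iff[OF lr'[OF uv(1)] lr'[OF uv(2)]]
      using True c[OF uv(1)] c[OF uv(2)] by (auto simp: l'_def r'_def)
    ultimately show ?thesis by simp
  next
    case False
    then show ?thesis
      using e[of u v] uv by (auto simp: extend_graph_def l'_def r'_def)
  qed
  moreover have "simple_graph (extend_graph V S I)"
    using sub V by (fastforce simp: simple_graph_def extend_graph_def vertex_pairs_def)
  ultimately show ?thesis
    unfolding interval_graph_def verts_extend_graph using lr' by blast
qed

lemma delete_verts_representation_graphs:
  "box_representation (delete_verts G S) Is \<Longrightarrow> I \<in> set Is \<Longrightarrow>
    interval_graph I \<and> verts I = verts G - S"
  by (auto simp: box_representation_def delete_verts_def)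

section \<open>Transfer between graphs and vertex numbers\<close>

locale enumerated_graph =
  fixes G :: "'a sgraph" and S :: "'a set" and vs :: "'a list"
  assumes simple: "simple_graph G" and enum: "enumerates vs (verts G)"
begin

definition n :: nat where "n = length vs"
definition A :: "nat \<Rightarrow> nat \<Rightarrow> bool" where "A u v \<longleftrightarrow> {vs ! u, vs ! v} \<in> edges G"
definition M :: "nat \<Rightarrow> bool" where "M v \<longleftrightarrow> vs ! v \<in> S"

sublocale masked_graph n A M .

lemma A_sym: "A u v \<Longrightarrow> A v u"
  unfolding A_def by (subst insert_commute)

lemma nth_in_verts: "u < n \<Longrightarrow> vs ! u \<in> verts G"
  using enum nth_mem[of u vs] by (simp add: enumerates_def n_def)

lemma nth_eq_iff: "u < n \<Longrightarrow> v < n \<Longrightarrow> vs ! u = vs ! v \<longleftrightarrow> u = v"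
  using enum by (simp add: enumerates_def n_def nth_eq_iff_index_eq)

lemma verts_nth: "x \<in> verts G \<Longrightarrow> \<exists>u<n. x = vs ! u"
proof -
  assume "x \<in> verts G"
  then have "x \<in> set vs" using enum by (simp add: enumerates_def)
  then show ?thesis by (auto simp: in_set_conv_nth n_def)
qed

definition hull_graph :: "(nat \<Rightarrow> nat) \<Rightarrow> nat \<Rightarrow> 'a sgraph" where
  "hull_graph X i = \<lparr>verts = verts G,
     edges = {{vs ! u, vs ! v} |u v. u < n \<and> v < n \<and> u \<noteq> v \<and> meets X i u v}\<rparr>"

lemma verts_hull_graph [simp]: "verts (hull_graph X i) = verts G"
  by (simp add: hull_graph_def)

lemma hull_graph_edge_iff:
  assumes "u < n" "v < n"
  shows "{vs ! u, vs ! v} \<in> edges (hull_graph X i) \<longleftrightarrow> u \<noteq> v \<and> meets X i u v"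
proof
  assume "{vs ! u, vs ! v} \<in> edges (hull_graph X i)"
  then obtain u' v' where "{vs ! u, vs ! v} = {vs ! u', vs ! v'}"
    "u' < n" "v' < n" "u' \<noteq> v'" "meets X i u' v'"
    by (auto simp: hull_graph_def)
  then show "u \<noteq> v \<and> meets X i u v"
    using assms meets_sym[of X i u v] by (auto simp: doubleton_eq_iff nth_eq_iff)
next
  assume "u \<noteq> v \<and> meets X i u v"
  then have "\<exists>u' v'. {vs ! u, vs ! v} = {vs ! u', vs ! v'} \<and> u' < n \<and> v' < n \<and> u' \<noteq> v' \<and> meets X i u' v'"
    using assms by (intro exI[of _ u] exI[of _ v]) simp
  then show "{vs ! u, vs ! v} \<in> edges (hull_graph X i)"
    by (simp add: hull_graph_def)
qed

lemma interval_graph_hull: "interval_graph (hull_graph X i)"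
proof -
  define pos where "pos x = (THE u. u < n \<and> vs ! u = x)" for x
  have pos: "pos (vs ! u) = u" if "u < n" for u
    unfolding pos_def using that nth_eq_iff by blast
  define l r where "l x = real (hull_lo X i (pos x))" and "r x = real (hull_hi X i (pos x))" for x
  have lr: "l x \<le> r x" if "x \<in> verts G" for x
    using verts_nth[OF that] hull_lo_le_hull_hi by (auto simp: l_def r_def pos)
  have "{x, y} \<in> edges (hull_graph X i) \<longleftrightarrow> {l x..r x} \<inter> {l y..r y} \<noteq> {}"
    if xy: "x \<in> verts G" "y \<in> verts G" "x \<noteq> y" for x y
  proof -
    obtain u v where uv: "u < n" "x = vs ! u" "v < n" "y = vs ! v"
      using verts_nth[OF xy(1)] verts_nth[OF xy(2)] by auto
    show ?thesis
      unfolding intervals_meet_iff[OF lr[OF xy(1)] lr[OF xy(2)]]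
      using uv xy(3) hull_graph_edge_iff[of u v X i] by (auto simp: l_def r_def pos meets_def)
  qed
  moreover have "simple_graph (hull_graph X i)"
    using simple nth_in_verts nth_eq_iff
    by (auto simp: simple_graph_def hull_graph_def vertex_pairs_def) blast
  ultimately show ?thesis
    unfolding interval_graph_def verts_hull_graph using lr by blast
qed

text \<open>The two halves share out the nonedges. A pair touching \<open>S\<close> is an edge of
  all extended graphs, so the hull graphs decide it; a pair outside \<open>S\<close> is exempt,
  hence an edge of all hull graphs, and the given representation decides it.\<close>

lemma box_representation_combined:
  assumes cov: "covers d X" and rep: "box_representation (delete_verts G S) Is"
  shows "box_representation G
    (map (hull_graph X) [0..<d] @ map (extend_graph (verts G) S) Is)" (is "box_representation G ?B")
proof -
  have fin: "finite (verts G)" and sub: "edges G \<subseteq> vertex_pairs (verts G)"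
    using simple by (auto simp: simple_graph_def)
  have ints: "interval_graph I \<and> verts I = verts G" if "I \<in> set ?B" for I
    using that interval_graph_hull interval_graph_extend[OF _ _ fin]
      delete_verts_representation_graphs[OF rep]
    by auto
  have rep_e: "{e \<in> edges G. e \<inter> S = {}} = vertex_pairs (verts G - S) \<inter> (\<Inter>I \<in> set Is. edges I)"
    using rep by (auto simp: box_representation_def delete_verts_def)
  have "e \<in> edges G \<longleftrightarrow> e \<in> vertex_pairs (verts G) \<inter> (\<Inter>I \<in> set ?B. edges I)" for e
  proof (cases "e \<in> vertex_pairs (verts G)")
    case True
    then obtain x y where "e = {x, y}" "x \<in> verts G" "y \<in> verts G" "x \<noteq> y"
      by (rule vertex_pairs_cases)
    then obtain u v where uv: "e = {vs ! u, vs ! v}" "u < n" "v < n" "u \<noteq> v"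
      using verts_nth[of x] verts_nth[of y] by auto
    have hull: "(\<forall>i<d. e \<in> edges (hull_graph X i)) \<longleftrightarrow> (\<forall>i<d. meets X i u v)"
      using hull_graph_edge_iff[OF uv(2,3)] uv by auto
    have extend_edges: "e \<in> edges (extend_graph (verts G) S I) \<longleftrightarrow> e \<in> edges I \<or> e \<inter> S \<noteq> {}" for I
      using True by (simp add: extend_graph_def)
    have e_iff: "e \<in> edges G \<longleftrightarrow> A u v" by (simp add: A_def uv(1))
    have out: "e \<inter> S = {} \<longleftrightarrow> \<not> M u \<and> \<not> M v" by (auto simp: M_def uv(1))
    have all: "e \<in> vertex_pairs (verts G) \<inter> (\<Inter>I \<in> set ?B. edges I) \<longleftrightarrow>
      (\<forall>i<d. meets X i u v) \<and> (\<forall>I \<in> set Is. e \<in> edges I \<or> e \<inter> S \<noteq> {})"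
      using True hull by (simp add: ball_Un extend_edges) auto
    show ?thesis
    proof (cases "e \<inter> S = {}")
      case inS: True
      then have "e \<in> vertex_pairs (verts G - S)"
        using uv nth_in_verts[of u] nth_in_verts[of v] nth_eq_iff[of u v]
        by (auto simp: vertex_pairs_iff)
      then have "e \<in> edges G \<longleftrightarrow> (\<forall>I \<in> set Is. e \<in> edges I)"
        using rep_e inS by blast
      moreover have "meets X i u v" for i
        using exempt_meets[of u v X i] out inS uv A_sym by (auto simp: exempt_def)
      ultimately show ?thesis unfolding all using inS by auto
    next
      case False
      then have "(\<forall>i<d. meets X i u v) \<longleftrightarrow> A u v"
        using cov exempt_meets[of u v X] A_sym uv out unfolding covers_def exempt_def by blast
      then show ?thesis unfolding all using False e_iff by auto
    qed
  qed (use sub in auto)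
  then show ?thesis
    unfolding box_representation_def using ints by blast
qed

text \<open>Coordinates of the factors are what the doubling needs: an edge of \<open>G\<close>
  meets in every factor, and a nonedge is separated in at least one.\<close>

lemma covers_of_box_representation:
  assumes "box_representation G Bs"
  shows "\<exists>X. (\<forall>j. X j < base) \<and> (\<forall>j \<ge> 2 * length Bs * base. X j = 0) \<and> covers (2 * length Bs) X"
proof -
  have "\<exists>l r :: 'a \<Rightarrow> real. (\<forall>v \<in> verts G. l v \<le> r v) \<and>
       (\<forall>u \<in> verts G. \<forall>v \<in> verts G. u \<noteq> v \<longrightarrow>
          ({u, v} \<in> edges (Bs ! i) \<longleftrightarrow> l u \<le> r v \<and> l v \<le> r u))" if i: "i < length Bs" for i
  proof -
    have "interval_graph (Bs ! i)" "verts (Bs ! i) = verts G"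
      using assms i by (auto simp: box_representation_def)
    then obtain l r :: "'a \<Rightarrow> real" where "\<forall>v \<in> verts G. l v \<le> r v"
      "\<forall>u \<in> verts G. \<forall>v \<in> verts G. u \<noteq> v \<longrightarrow>
          ({u, v} \<in> edges (Bs ! i) \<longleftrightarrow> {l u..r u} \<inter> {l v..r v} \<noteq> {})"
      unfolding interval_graph_def by metis
    then show ?thesis
      by (simp add: intervals_meet_iff) blast
  qed
  then obtain l r :: "nat \<Rightarrow> 'a \<Rightarrow> real" where
    lr: "\<And>i v. i < length Bs \<Longrightarrow> v \<in> verts G \<Longrightarrow> l i v \<le> r i v" and
    e: "\<And>i u v. i < length Bs \<Longrightarrow> u \<in> verts G \<Longrightarrow> v \<in> verts G \<Longrightarrow> u \<noteq> v \<Longrightarrow>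
      {u, v} \<in> edges (Bs ! i) \<longleftrightarrow> l i u \<le> r i v \<and> l i v \<le> r i u"
    by metis
  have G_e: "edges G = vertex_pairs (verts G) \<inter> (\<Inter>I \<in> set Bs. edges I)"
    using assms by (auto simp: box_representation_def)
  show ?thesis
  proof (rule covers_double[where l = "\<lambda>i v. l i (vs ! v)" and r = "\<lambda>i v. r i (vs ! v)"])
    fix i u v assume a: "i < length Bs" "u < n" "v < n" "A u v"
    then have "vs ! u \<noteq> vs ! v" "{vs ! u, vs ! v} \<in> edges (Bs ! i)"
      using G_e by (auto simp: A_def vertex_pairs_iff)
    then show "l i (vs ! u) \<le> r i (vs ! v) \<and> l i (vs ! v) \<le> r i (vs ! u)"
      using e a nth_in_verts by blast
  next
    fix u v assume a: "u < n" "v < n" "\<not> exempt u v"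
    then have "u \<noteq> v" "\<not> A u v" by (auto simp: exempt_def)
    then obtain I where "I \<in> set Bs" "{vs ! u, vs ! v} \<notin> edges I"
      using G_e a nth_in_verts nth_eq_iff[OF a(1,2)] by (auto simp: A_def vertex_pairs_iff)
    then obtain i where i: "i < length Bs" "{vs ! u, vs ! v} \<notin> edges (Bs ! i)"
      by (auto simp: in_set_conv_nth)
    then show "\<exists>i<length Bs. r i (vs ! u) < l i (vs ! v) \<or> r i (vs ! v) < l i (vs ! u)"
      using e[OF i(1), of "vs ! u" "vs ! v"] a nth_in_verts nth_eq_iff[OF a(1,2)] \<open>u \<noteq> v\<close>
      by (metis not_le)
  qed (use lr nth_in_verts in auto)
qed

text \<open>The better of two covers, the doubled optimal representation and the one with a
  dimension per modulator vertex. The first bound limits the output, the second the length of the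
  search.\<close>

lemma exists_small_cover:
  assumes rep: "box_representation (delete_verts G S) Is"
  shows "\<exists>d X. d \<le> 2 * boxicity G \<and> d \<le> rk M n \<and> (\<forall>j. X j < base) \<and> (\<forall>j \<ge> d * base. X j = 0) \<and> covers d X"
proof -
  obtain X where X: "\<forall>j. X j < base" "\<forall>j \<ge> rk M n * base. X j = 0" "covers (rk M n) X"
    using covers_masked A_sym by blast
  have "\<exists>Bs. box_representation G Bs \<and> length Bs = boxicity G"
  proof (cases "complete_graph G")
    case True
    then show ?thesis
      by (intro exI[of _ "[]"]) (auto simp: boxicity_def box_representation_def complete_graph_def)
  next
    case False
    \<comment> \<open>The \<open>LEAST\<close> in \<open>boxicity\<close> needs some representation
      to exist; the cover by modulator vertices, combined with \<open>Is\<close>, supplies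
      one.\<close>
    have "\<exists>k Bs. box_representation G Bs \<and> length Bs = k"
      using box_representation_combined[OF X(3) rep] by blast
    then show ?thesis
      unfolding boxicity_def using False
      by (simp only: if_False) (rule LeastI_ex)
  qed
  then obtain Bs where Bs: "box_representation G Bs" "length Bs = boxicity G" by blast
  show ?thesis
  proof (cases "2 * boxicity G \<le> rk M n")
    case True
    then show ?thesis using covers_of_box_representation[OF Bs(1)] Bs(2) by auto
  next
    case False
    then show ?thesis using X by (intro exI[of _ "rk M n"] exI[of _ X]) auto
  qed
qed

lemma rk_card: "S \<subseteq> verts G \<Longrightarrow> rk M n = card S"
proof -
  assume S: "S \<subseteq> verts G"
  have "(!) vs ` {u. u < n \<and> M u} = S"
    using S verts_nth by (fastforce simp: M_def)
  moreover have "inj_on ((!) vs) {u. u < n \<and> M u}"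
    by (auto simp: inj_on_def nth_eq_iff)
  ultimately show ?thesis
    unfolding rk_def by (metis card_image)
qed

end

section \<open>Generating and testing a candidate\<close>

lemma row_index_inj:
  fixes n :: nat
  assumes "v < n" "v' < n"
  shows "u * n + v = u' * n + v' \<longleftrightarrow> u = u' \<and> v = v'"
proof
  assume e: "u * n + v = u' * n + v'"
  have "(u * n + v) div n = u" "(u' * n + v') div n = u'" using assms by auto
  then show "u = u' \<and> v = v'" using e by auto
qed auto

lemma row_index_div_mod:
  fixes n :: nat
  assumes "v < n"
  shows "(u * n + v) div n = u" "(u * n + v) mod n = v"
  using assms by auto

lemma row_index_less:
  fixes n :: nat
  assumes "u < k" "v < n"
  shows "u * n + v < k * n"
proof -
  have "u * n + v < Suc u * n" using assms by simp
  also have "\<dots> \<le> k * n" using assms by (intro mult_right_mono) auto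
  finally show ?thesis .
qed

lemma row_index_less_Suc:
  fixes n :: nat
  assumes "v < n" "v' < n"
  shows "u * n + v < Suc (u' * n + v') \<longleftrightarrow> u * n + v < u' * n + v' \<or> u = u' \<and> v = v'"
  using row_index_inj[OF assms] by (auto simp: less_Suc_eq)

lemma diff_diff_eq_min: "x - (x - y) = min x (y :: nat)"
  by auto

lemma add_diff_eq_max: "x + (y - x) = max x (y :: nat)"
  by auto

text \<open>Array names; a name starting with \<open>v\<close> is used as a variable, held in cell 0.\<close>

abbreviation (input) vN :: nat where "vN \<equiv> 2"
abbreviation (input) vNN :: nat where "vNN \<equiv> 3"
abbreviation (input) aAdj :: nat where "aAdj \<equiv> 4"
abbreviation (input) aMask :: nat where "aMask \<equiv> 5"
abbreviation (input) vCount :: nat where "vCount \<equiv> 6"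
abbreviation (input) vI :: nat where "vI \<equiv> 7"
abbreviation (input) vJ :: nat where "vJ \<equiv> 8"
abbreviation (input) vW :: nat where "vW \<equiv> 9"
abbreviation (input) vQ :: nat where "vQ \<equiv> 10"
abbreviation (input) vDim :: nat where "vDim \<equiv> 11"
abbreviation (input) vBase :: nat where "vBase \<equiv> 12"
abbreviation (input) vLen :: nat where "vLen \<equiv> 13"
abbreviation (input) aDig :: nat where "aDig \<equiv> 14"
abbreviation (input) vPos :: nat where "vPos \<equiv> 15"
abbreviation (input) vC :: nat where "vC \<equiv> 16"
abbreviation (input) aLo :: nat where "aLo \<equiv> 17"
abbreviation (input) aHi :: nat where "aHi \<equiv> 18"
abbreviation (input) aL :: nat where "aL \<equiv> 19"
abbreviation (input) aR :: nat where "aR \<equiv> 20"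
abbreviation (input) aRep :: nat where "aRep \<equiv> 21"
abbreviation (input) vK :: nat where "vK \<equiv> 22"
abbreviation (input) vBad :: nat where "vBad \<equiv> 23"
abbreviation (input) vCov :: nat where "vCov \<equiv> 24"
abbreviation (input) vX :: nat where "vX \<equiv> 25"
abbreviation (input) vCarry :: nat where "vCarry \<equiv> 26"
abbreviation (input) vSkip :: nat where "vSkip \<equiv> 27"
abbreviation (input) vY :: nat where "vY \<equiv> 28"
abbreviation (input) vGiven :: nat where "vGiven \<equiv> 29"

abbreviation Skip :: prog where "Skip \<equiv> Set vSkip (Lit 0)"

text \<open>With truncated subtraction this is the distance of the two indices, so
  \<open>Minus (Lit 1) absdiff\<close> is the test for equality as a number 0 or 1.\<close>

abbreviation (input) absdiff :: expr where
  "absdiff \<equiv> Plus (Minus (Var vI) (Var vJ)) (Minus (Var vJ) (Var vI))"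

text \<open>Digits are consumed in sequence through \<open>vPos\<close>, which replaces the address
  computation in \<open>lo\<close> and \<open>hi\<close>. The hull arrays start as copies of the
  digits.\<close>

definition load_body :: prog where
  "load_body = Seq
     (If (Cell aMask (Var vJ))
       (Seq (Assign aLo (Var vJ) (Cell aDig (Var vPos)))
       (Seq (Assign aHi (Var vJ) (Cell aDig (Plus (Var vPos) (Lit 1))))
            (Set vPos (Plus (Var vPos) (Lit 2)))))
       (Seq (Assign aLo (Var vJ) (Var vC)) (Assign aHi (Var vJ) (Var vC))))
     (Seq (Assign aL (Var vJ) (Cell aLo (Var vJ))) (Assign aR (Var vJ) (Cell aHi (Var vJ))))"

text \<open>With truncated subtraction, \<open>x - (x - y) = min x y\<close> and \<open>x + (y - x) = max x y\<close>.\<close>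

definition shrink_body :: prog where
  "shrink_body =
     If (Minus (Cell aMask (Var vI)) (Minus (Lit 1) (Plus (Cell aAdj (Var vW)) (Minus (Lit 1) absdiff))))
       (Seq (Assign aL (Var vJ) (Minus (Cell aL (Var vJ)) (Minus (Cell aL (Var vJ)) (Cell aHi (Var vI)))))
            (Assign aR (Var vJ) (Plus (Cell aR (Var vJ)) (Minus (Cell aLo (Var vI)) (Cell aR (Var vJ))))))
       Skip"

definition hull_prog :: prog where
  "hull_prog = Seq (Seq (Set vC (Cell aDig (Var vPos))) (Inc vPos))
     (Seq (For vJ vN load_body) (For2 vI vJ vW vN shrink_body))"

text \<open>The first term is 1 off the diagonal and 0 on it. What is subtracted vanishes exactly if
  neither interval lies strictly to the right of the other.\<close>

definition entry_body :: prog where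
  "entry_body = Seq
     (Assign aRep (Var vQ) (Minus (Minus (Lit 1) (Minus (Lit 1) absdiff))
       (Plus (Minus (Cell aL (Var vI)) (Cell aR (Var vJ))) (Minus (Cell aL (Var vJ)) (Cell aR (Var vI))))))
     (Inc vQ)"

text \<open>\<open>vQ\<close> starts at 1 because cell 0 of the output is reserved for the number of
  graphs. Neither position is reset between dimensions, so blocks and matrices follow one another
  without gaps.\<close>

definition gen_prog :: prog where
  "gen_prog = Seq (Seq (Set vPos (Lit 0)) (Set vQ (Lit 1)))
     (For vK vDim (Seq hull_prog (For2 vI vJ vW vN entry_body)))"

text \<open>\<open>vX\<close> visits the entries of one pair in all matrices in strides of
  \<open>n * n\<close>. \<open>vCov\<close> is positive once there is a reason to accept the pair,
  and \<open>vBad\<close> counts the pairs without one.\<close>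

definition check_body :: prog where
  "check_body = Seq
     (Seq (Set vCov (Plus (Cell aAdj (Var vW)) (Plus (Minus (Lit 1) absdiff)
            (Minus (Lit 1) (Plus (Cell aMask (Var vI)) (Cell aMask (Var vJ)))))))
          (Set vX (Plus (Var vW) (Lit 1))))
     (Seq (For vK vDim (Seq (Set vCov (Plus (Var vCov) (Minus (Lit 1) (Cell aRep (Var vX)))))
                            (Set vX (Plus (Var vX) (Var vNN)))))
          (Set vBad (Plus (Var vBad) (Minus (Lit 1) (Var vCov)))))"

definition check_prog :: prog where
  "check_prog = Seq (Set vBad (Lit 0)) (For2 vI vJ vW vN check_body)"

lemma writes_load_body [simp]: "writes load_body = {vPos, aLo, aHi, aL, aR}"
  by (auto simp: load_body_def)

lemma writes_shrink_body [simp]: "writes shrink_body = {aL, aR, vSkip}"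
  by (auto simp: shrink_body_def)

lemma writes_hull_prog [simp]:
  "writes hull_prog = {vC, vPos, aLo, aHi, aL, aR, vSkip, vI, vJ, vW}"
  by (auto simp: hull_prog_def)

lemma writes_entry_body [simp]: "writes entry_body = {aRep, vQ}"
  by (auto simp: entry_body_def)

lemma writes_gen_prog [simp]:
  "writes gen_prog = {vC, vPos, aLo, aHi, aL, aR, vSkip, vI, vJ, vW, vK, aRep, vQ}"
  by (auto simp: gen_prog_def)

lemma writes_check_body [simp]: "writes check_body = {vCov, vX, vK, vBad}"
  by (auto simp: check_body_def)

lemma writes_check_prog [simp]: "writes check_prog = {vCov, vX, vK, vBad, vI, vJ, vW}"
  by (auto simp: check_prog_def)

section \<open>Correctness and cost of the candidate test\<close>

context masked_graph
begin

definition loaded :: "store \<Rightarrow> bool" where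
  "loaded s \<longleftrightarrow> s vN 0 = n \<and> s vNN 0 = n * n \<and>
     (\<forall>u<n. \<forall>v<n. s aAdj (u * n + v) = of_bool (A u v)) \<and> (\<forall>v<n. s aMask v = of_bool (M v))"

lemma loadedD:
  assumes "loaded s"
  shows "s vN 0 = n" "s vNN 0 = n * n"
    "\<And>u v. u < n \<Longrightarrow> v < n \<Longrightarrow> s aAdj (u * n + v) = of_bool (A u v)"
    "\<And>v. v < n \<Longrightarrow> s aMask v = of_bool (M v)"
  using assms by (auto simp: loaded_def)

lemma loaded_cong:
  "s' vN = s vN \<Longrightarrow> s' vNN = s vNN \<Longrightarrow> s' aAdj = s aAdj \<Longrightarrow> s' aMask = s aMask \<Longrightarrow>
    loaded s' = loaded s"
  by (simp add: loaded_def)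

text \<open>Before vertex \<open>j\<close> the reading position has passed the common point and two
  digits for each marked vertex below \<open>j\<close>. At the end it has moved on by
  \<open>base\<close> in total and stands at the next block.\<close>

lemma load_spec:
  assumes ld: "loaded s0" and X: "s0 aDig = X" and C: "s0 vC 0 = X (i * base)"
    and P: "s0 vPos 0 = i * base + 1"
  shows "reaches (For vJ vN load_body) s0 (n * 50 + 9) (\<lambda>s. s vPos 0 = Suc i * base \<and>
    (\<forall>v<n. s aLo v = lo X i v \<and> s aHi v = hi X i v \<and> s aL v = lo X i v \<and> s aR v = hi X i v))"
proof -
  let ?I = "\<lambda>j s. s vPos 0 = i * base + 1 + 2 * rk M j \<and>
    (\<forall>v<j. s aLo v = lo X i v \<and> s aHi v = hi X i v \<and> s aL v = lo X i v \<and> s aR v = hi X i v)"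
  have "reaches (For vJ vN load_body) s0 (n * (38 + 12) + 9) (?I n)"
  proof (rule For_rule[where I = ?I])
    fix j s
    assume j: "j < n" and fr: "\<And>x. x \<noteq> vJ \<Longrightarrow> x \<notin> writes load_body \<Longrightarrow> s x = s0 x"
      and sj: "s vJ 0 = j" and I: "?I j s"
    have fr': "s aMask = s0 aMask" "s aDig = s0 aDig" "s vC = s0 vC"
      using fr by auto
    have mask: "s aMask j = of_bool (M j)" using loadedD(4)[OF ld j] fr' by simp
    show "reaches load_body s 38 (?I (Suc j))"
      by (rule reaches_straight; cases "M j")
        (use I sj mask fr' C X in \<open>auto simp: load_body_def lo_def hi_def rk_Suc less_Suc_eq algebra_simps\<close>)
  qed (use P loadedD(1)[OF ld] in auto)
  then show ?thesis
    by (rule reaches_mono) (auto simp: base_def)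
qed

text \<open>Running minima and maxima: \<open>U w v\<close> collects the vertices relevant for
  \<open>v\<close> among the first \<open>w\<close> pairs of the sweep. The guard, mask minus (1
  minus (adjacency plus equality)), is positive precisely for marked \<open>u\<close> with
  \<open>A u v\<close> or \<open>u = v\<close>. Endpoints of \<open>u\<close> are read from
  \<open>aLo\<close> and \<open>aHi\<close>, which the sweep does not change.\<close>

lemma shrink_spec:
  assumes ld: "loaded s0" and n: "1 \<le> n"
    and lohi: "\<forall>v<n. s0 aLo v = lo X i v \<and> s0 aHi v = hi X i v \<and> s0 aL v = lo X i v \<and> s0 aR v = hi X i v"
  shows "reaches (For2 vI vJ vW vN shrink_body) s0 (n * n * 103)
    (\<lambda>s. \<forall>v<n. s aL v = hull_lo X i v \<and> s aR v = hull_hi X i v)"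
proof -
  define U where "U w v = {u. u < n \<and> M u \<and> (A u v \<or> u = v) \<and> u * n + v < w}" for w v
  have finU: "finite (U w v)" for w v by (simp add: U_def)
  have U_Suc: "U (Suc (u * n + v)) v' =
      (if v' = v \<and> M u \<and> (A u v \<or> u = v) then insert u (U (u * n + v) v') else U (u * n + v) v')"
    if "u < n" "v < n" "v' < n" for u v v'
    unfolding U_def using that by (auto simp: row_index_less_Suc)
  let ?I = "\<lambda>w s. \<forall>v<n. s aL v = Min (insert (lo X i v) (hi X i ` U w v)) \<and>
    s aR v = Max (insert (hi X i v) (lo X i ` U w v))"
  have "reaches (For2 vI vJ vW vN shrink_body) s0 (n * n * (52 + 51)) (?I (n * n))"
  proof (rule For2_rule[where I = ?I])
    fix u v s
    assume uv: "u < n" "v < n"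
      and fr: "\<And>x. x \<noteq> vI \<Longrightarrow> x \<noteq> vJ \<Longrightarrow> x \<noteq> vW \<Longrightarrow> x \<notin> writes shrink_body \<Longrightarrow> s x = s0 x"
      and idx: "s vI 0 = u" "s vJ 0 = v" "s vW 0 = u * n + v" and I: "?I (u * n + v) s"
    have fr': "s aMask = s0 aMask" "s aAdj = s0 aAdj" "s aLo = s0 aLo" "s aHi = s0 aHi"
      using fr by auto
    have inp: "s aMask u = of_bool (M u)" "s aAdj (u * n + v) = of_bool (A u v)"
      "s aLo u = lo X i u" "s aHi u = hi X i u"
      using loadedD[OF ld] uv fr' lohi by auto
    define l r where "l = Min (insert (lo X i v) (hi X i ` U (u * n + v) v))"
      and "r = Max (insert (hi X i v) (lo X i ` U (u * n + v) v))"
    have lr: "s aL v = l" "s aR v = r" using I uv by (auto simp: l_def r_def)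
    have new: "Min (insert (lo X i v) (insert (hi X i u) (hi X i ` U (u * n + v) v))) = min l (hi X i u)"
      "Max (insert (hi X i v) (insert (lo X i u) (lo X i ` U (u * n + v) v))) = max r (lo X i u)"
      using finU by (auto simp: l_def r_def insert_commute[of "lo X i v"] insert_commute[of "hi X i v"]
        min.commute max.commute)
    show "reaches shrink_body s 52 (?I (Suc (u * n + v)))"
    proof (rule reaches_straight)
      show "?I (Suc (u * n + v)) (straight_run shrink_body s)"
      proof (cases "M u \<and> (A u v \<or> u = v)")
        case True
        have "straight_run shrink_body s =
          s(aL := (s aL)(v := min l (hi X i u)), aR := (s aR)(v := max r (lo X i u)))"
          using True idx inp lr by (auto simp: shrink_body_def diff_diff_eq_min add_diff_eq_max)
        then show ?thesis
          using True I uv by (auto simp: U_Suc new)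
      next
        case False
        have "straight_run shrink_body s = s(vSkip := (s vSkip)(0 := 0))"
          using False idx inp by (auto simp: shrink_body_def)
        then show ?thesis
          using False I uv by (auto simp: U_Suc)
      qed
    qed (auto simp: shrink_body_def)
  next
    show "?I 0 s0" using lohi by (simp add: U_def)
  qed (use loadedD(1)[OF ld] n in auto)
  then show ?thesis
  proof (rule reaches_mono)
    fix s assume I: "?I (n * n) s"
    have "U (n * n) v = {u. u < n \<and> M u \<and> (A u v \<or> u = v)}" if "v < n" for v
      unfolding U_def using row_index_less[of _ n v n] that by auto
    then show "\<forall>v<n. s aL v = hull_lo X i v \<and> s aR v = hull_hi X i v"
      using I by (simp add: hull_lo_def hull_hi_def)
  qed auto
qed

lemma hull_spec:
  assumes ld: "loaded s0" and n: "1 \<le> n" and X: "s0 aDig = X" and P: "s0 vPos 0 = i * base"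
  shows "reaches hull_prog s0 (n * n * 180)
    (\<lambda>s. s vPos 0 = Suc i * base \<and> (\<forall>v<n. s aL v = hull_lo X i v \<and> s aR v = hull_hi X i v))"
proof -
  have "reaches hull_prog s0 (15 + ((n * 50 + 9) + n * n * 103))
    (\<lambda>s. s vPos 0 = Suc i * base \<and> (\<forall>v<n. s aL v = hull_lo X i v \<and> s aR v = hull_hi X i v))"
    unfolding hull_prog_def
  proof (rule reaches_Seq_frame)
    show "reaches (Seq (Set vC (Cell aDig (Var vPos))) (Inc vPos)) s0 15
      (\<lambda>s. s vC 0 = X (i * base) \<and> s vPos 0 = i * base + 1)"
      by (rule reaches_straight) (use X P in auto)
    fix s1 assume 1: "s1 vC 0 = X (i * base) \<and> s1 vPos 0 = i * base + 1"
      and fr1: "\<And>x. x \<notin> writes (Seq (Set vC (Cell aDig (Var vPos))) (Inc vPos)) \<Longrightarrow> s1 x = s0 x"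
    have ld1: "loaded s1" by (subst loaded_cong[of _ s0]) (use ld fr1 in auto)
    show "reaches (Seq (For vJ vN load_body) (For2 vI vJ vW vN shrink_body)) s1
      ((n * 50 + 9) + n * n * 103)
      (\<lambda>s. s vPos 0 = Suc i * base \<and> (\<forall>v<n. s aL v = hull_lo X i v \<and> s aR v = hull_hi X i v))"
    proof (rule reaches_Seq_frame[OF load_spec[OF ld1]])
      show "s1 aDig = X" using X fr1 by auto
      show "s1 vC 0 = X (i * base)" "s1 vPos 0 = i * base + 1" using 1 by auto
      fix s2
      assume 2: "s2 vPos 0 = Suc i * base \<and> (\<forall>v<n. s2 aLo v = lo X i v \<and> s2 aHi v = hi X i v \<and>
          s2 aL v = lo X i v \<and> s2 aR v = hi X i v)"
        and fr2: "\<And>x. x \<notin> writes (For vJ vN load_body) \<Longrightarrow> s2 x = s1 x"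
      have ld2: "loaded s2" by (subst loaded_cong[of _ s1]) (use ld1 fr2 in auto)
      have "reaches (For2 vI vJ vW vN shrink_body) s2 (n * n * 103)
        (\<lambda>s. \<forall>v<n. s aL v = hull_lo X i v \<and> s aR v = hull_hi X i v)"
        by (rule shrink_spec[OF ld2 n]) (use 2 in auto)
      from reaches_frame[OF this]
      show "reaches (For2 vI vJ vW vN shrink_body) s2 (n * n * 103)
        (\<lambda>s. s vPos 0 = Suc i * base \<and> (\<forall>v<n. s aL v = hull_lo X i v \<and> s aR v = hull_hi X i v))"
        by (rule reaches_mono) (use 2 in auto)
    qed
  qed
  moreover have "15 + ((n * 50 + 9) + n * n * 103) \<le> n * n * 180"
  proof -
    have "n \<le> n * n" "1 \<le> n * n" using n by auto
    then show ?thesis by linarith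
  qed
  ultimately show ?thesis by (rule reaches_mono)
qed

text \<open>The layout of \<open>rep_code\<close> with the leading length still missing, hence the
  offset 1.\<close>

definition rep_entries :: "(nat \<Rightarrow> nat) \<Rightarrow> nat \<Rightarrow> (nat \<Rightarrow> nat) \<Rightarrow> bool" where
  "rep_entries X d f \<longleftrightarrow> (\<forall>i<d. \<forall>u<n. \<forall>v<n.
     f (1 + i * (n * n) + (u * n + v)) = of_bool (u \<noteq> v \<and> meets X i u v))"

lemma entry_spec:
  assumes ld: "loaded s0" and n: "1 \<le> n" and q: "s0 vQ 0 = q"
    and LR: "\<forall>v<n. s0 aL v = hull_lo X i v \<and> s0 aR v = hull_hi X i v"
  shows "reaches (For2 vI vJ vW vN entry_body) s0 (n * n * 100)
    (\<lambda>s. s vQ 0 = q + n * n \<and> (\<forall>x<q. s aRep x = s0 aRep x) \<and>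
      (\<forall>u<n. \<forall>v<n. s aRep (q + (u * n + v)) = of_bool (u \<noteq> v \<and> meets X i u v)))"
proof -
  let ?I = "\<lambda>w s. s vQ 0 = q + w \<and> (\<forall>x<q. s aRep x = s0 aRep x) \<and>
    (\<forall>u<n. \<forall>v<n. u * n + v < w \<longrightarrow> s aRep (q + (u * n + v)) = of_bool (u \<noteq> v \<and> meets X i u v))"
  have "reaches (For2 vI vJ vW vN entry_body) s0 (n * n * (49 + 51)) (?I (n * n))"
  proof (rule For2_rule[where I = ?I])
    fix u v s
    assume uv: "u < n" "v < n"
      and fr: "\<And>x. x \<noteq> vI \<Longrightarrow> x \<noteq> vJ \<Longrightarrow> x \<noteq> vW \<Longrightarrow> x \<notin> writes entry_body \<Longrightarrow> s x = s0 x"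
      and idx: "s vI 0 = u" "s vJ 0 = v" "s vW 0 = u * n + v" and I: "?I (u * n + v) s"
    have fr': "s aL = s0 aL" "s aR = s0 aR" using fr by auto
    have inp: "s aL u = hull_lo X i u" "s aL v = hull_lo X i v" "s aR u = hull_hi X i u"
      "s aR v = hull_hi X i v"
      using fr' LR uv by auto
    have "straight_run entry_body s = s(aRep := (s aRep)(q + (u * n + v) := of_bool (u \<noteq> v \<and> meets X i u v)),
      vQ := (s vQ)(0 := q + Suc (u * n + v)))"
      using I idx inp by (auto simp: entry_body_def meets_def)
    then show "reaches entry_body s 49 (?I (Suc (u * n + v)))"
      by (intro reaches_straight)
        (use I uv in \<open>auto simp: entry_body_def row_index_less_Suc row_index_inj\<close>)
  qed (use q loadedD(1)[OF ld] n in auto)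
  then show ?thesis
    by (rule reaches_mono) (use row_index_less[of _ n _ n] in auto)
qed

lemma gen_spec:
  assumes ld: "loaded s0" and n: "1 \<le> n" and X: "s0 aDig = X" and d: "s0 vDim 0 = d"
  shows "reaches gen_prog s0 (n * n * (d * 300 + 20))
    (\<lambda>s. s vQ 0 = 1 + d * (n * n) \<and> rep_entries X d (s aRep))"
proof -
  let ?I = "\<lambda>i s. s vPos 0 = i * base \<and> s vQ 0 = 1 + i * (n * n) \<and> rep_entries X i (s aRep)"
  let ?body = "Seq hull_prog (For2 vI vJ vW vN entry_body)"
  have "reaches gen_prog s0 (6 + (d * (n * n * 280 + 12) + 9)) (?I d)"
    unfolding gen_prog_def
  proof (rule reaches_Seq_frame)
    show "reaches (Seq (Set vPos (Lit 0)) (Set vQ (Lit 1))) s0 6 (\<lambda>s. s vPos 0 = 0 \<and> s vQ 0 = 1)"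
      by (rule reaches_straight) auto
    fix s1 assume 1: "s1 vPos 0 = 0 \<and> s1 vQ 0 = 1"
      and fr1: "\<And>x. x \<notin> writes (Seq (Set vPos (Lit 0)) (Set vQ (Lit 1))) \<Longrightarrow> s1 x = s0 x"
    have ld1: "loaded s1" by (subst loaded_cong[of _ s0]) (use ld fr1 in auto)
    show "reaches (For vK vDim ?body) s1 (d * (n * n * 280 + 12) + 9) (?I d)"
    proof (rule For_rule[where I = ?I])
      fix i s
      assume i: "i < d" and fr: "\<And>x. x \<noteq> vK \<Longrightarrow> x \<notin> writes ?body \<Longrightarrow> s x = s1 x"
        and I: "?I i s"
      have lds: "loaded s" by (subst loaded_cong[of _ s1]) (use ld1 fr in auto)
      have Xs: "s aDig = X" using X fr fr1 by auto
      have "reaches ?body s (n * n * 180 + n * n * 100) (?I (Suc i))"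
      proof (rule reaches_Seq_frame[OF hull_spec[OF lds n Xs]])
        show "s vPos 0 = i * base" using I by simp
        fix s2
        assume 2: "s2 vPos 0 = Suc i * base \<and> (\<forall>v<n. s2 aL v = hull_lo X i v \<and> s2 aR v = hull_hi X i v)"
          and fr2: "\<And>x. x \<notin> writes hull_prog \<Longrightarrow> s2 x = s x"
        have ld2: "loaded s2" by (subst loaded_cong[of _ s]) (use lds fr2 in auto)
        have fr2': "s2 vQ = s vQ" "s2 aRep = s aRep" using fr2 by auto
        have "reaches (For2 vI vJ vW vN entry_body) s2 (n * n * 100)
          (\<lambda>s'. s' vQ 0 = 1 + i * (n * n) + n * n \<and> (\<forall>x<1 + i * (n * n). s' aRep x = s2 aRep x) \<and>
           (\<forall>u<n. \<forall>v<n. s' aRep (1 + i * (n * n) + (u * n + v)) = of_bool (u \<noteq> v \<and> meets X i u v)))"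
          by (rule entry_spec[OF ld2 n]) (use 2 fr2' I in auto)
        from reaches_frame[OF this]
        show "reaches (For2 vI vJ vW vN entry_body) s2 (n * n * 100) (?I (Suc i))"
        proof (rule reaches_mono)
          fix s3
          assume 3: "(s3 vQ 0 = 1 + i * (n * n) + n * n \<and> (\<forall>x<1 + i * (n * n). s3 aRep x = s2 aRep x) \<and>
             (\<forall>u<n. \<forall>v<n. s3 aRep (1 + i * (n * n) + (u * n + v)) = of_bool (u \<noteq> v \<and> meets X i u v))) \<and>
            (\<forall>x. x \<notin> writes (For2 vI vJ vW vN entry_body) \<longrightarrow> s3 x = s2 x)"
          have old: "1 + i' * (n * n) + (u * n + v) < 1 + i * (n * n)" if "i' < i" "u < n" "v < n" for i' u v
            using row_index_less[OF that(1), of "u * n + v" "n * n"] row_index_less[OF that(2,3)] by simp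
          have "rep_entries X (Suc i) (s3 aRep)"
            unfolding rep_entries_def
          proof (intro allI impI)
            fix i' u v assume a: "i' < Suc i" "u < n" "v < n"
            show "s3 aRep (1 + i' * (n * n) + (u * n + v)) = of_bool (u \<noteq> v \<and> meets X i' u v)"
            proof (cases "i' = i")
              case False
              then have "i' < i" using a by simp
              with 3 old[OF this a(2,3)] fr2' I a show ?thesis
                unfolding rep_entries_def by metis
            qed (use 3 a in auto)
          qed
          then show "?I (Suc i) s3" using 2 3 by auto
        qed auto
      qed
      then show "reaches ?body s (n * n * 280) (?I (Suc i))"
        by (rule reaches_mono) auto
    qed (use 1 fr1 d in \<open>auto simp: rep_entries_def\<close>)
  qed
  moreover have "6 + (d * (n * n * 280 + 12) + 9) \<le> n * n * (d * 300 + 20)"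
  proof -
    have nn: "1 \<le> n * n" using n by auto
    have "12 * d + 15 \<le> 20 * (n * n * d) + 20 * (n * n)"
      using mult_le_mono1[OF nn, of d] nn by linarith
    then show ?thesis by (simp add: algebra_simps)
  qed
  ultimately show ?thesis by (rule reaches_mono) auto
qed

lemma check_spec:
  assumes ld: "loaded s0" and n: "1 \<le> n" and d: "s0 vDim 0 = d" and R: "rep_entries X d (s0 aRep)"
  shows "reaches check_prog s0 (n * n * (d * 40 + 150)) (\<lambda>s. s vBad 0 = 0 \<longleftrightarrow> covers d X)"
proof -
  let ?in = "Seq (Set vCov (Plus (Var vCov) (Minus (Lit 1) (Cell aRep (Var vX)))))
                            (Set vX (Plus (Var vX) (Var vNN)))"
  let ?P = "\<lambda>u v. exempt u v \<or> (\<exists>i<d. \<not> meets X i u v)"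
  let ?I = "\<lambda>w s. s vBad 0 = 0 \<longleftrightarrow> (\<forall>u<n. \<forall>v<n. u * n + v < w \<longrightarrow> ?P u v)"
  have "reaches check_prog s0 (3 + n * n * ((35 + ((d * (19 + 12) + 9) + 10)) + 51)) (?I (n * n))"
    unfolding check_prog_def
  proof (rule reaches_Seq_frame)
    show "reaches (Set vBad (Lit 0)) s0 3 (\<lambda>s. s vBad 0 = 0)"
      by (rule reaches_straight) auto
    fix s1 assume 1: "s1 vBad 0 = 0" and fr1: "\<And>x. x \<notin> writes (Set vBad (Lit 0)) \<Longrightarrow> s1 x = s0 x"
    have ld1: "loaded s1" by (subst loaded_cong[of _ s0]) (use ld fr1 in auto)
    have s1: "s1 vDim 0 = d" "rep_entries X d (s1 aRep)" using d R fr1 by auto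
    show "reaches (For2 vI vJ vW vN check_body) s1
      (n * n * ((35 + ((d * (19 + 12) + 9) + 10)) + 51)) (?I (n * n))"
    proof (rule For2_rule[where I = ?I])
      fix u v s
      assume uv: "u < n" "v < n"
        and fr: "\<And>x. x \<noteq> vI \<Longrightarrow> x \<noteq> vJ \<Longrightarrow> x \<noteq> vW \<Longrightarrow> x \<notin> writes check_body \<Longrightarrow> s x = s1 x"
        and idx: "s vI 0 = u" "s vJ 0 = v" "s vW 0 = u * n + v" and I: "?I (u * n + v) s"
      have lds: "loaded s" by (subst loaded_cong[of _ s1]) (use ld1 fr in auto)
      have sd: "s vDim 0 = d" "rep_entries X d (s aRep)" using s1 fr by auto
      show "reaches check_body s (35 + ((d * (19 + 12) + 9) + 10)) (?I (Suc (u * n + v)))"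
        unfolding check_body_def
      proof (rule reaches_Seq_frame)
        let ?init = "Seq (Set vCov (Plus (Cell aAdj (Var vW)) (Plus (Minus (Lit 1) absdiff)
            (Minus (Lit 1) (Plus (Cell aMask (Var vI)) (Cell aMask (Var vJ)))))))
          (Set vX (Plus (Var vW) (Lit 1)))"
        show "reaches ?init s 35 (\<lambda>s. (s vCov 0 \<noteq> 0 \<longleftrightarrow> exempt u v) \<and> s vX 0 = 1 + (u * n + v))"
          by (rule reaches_straight)
            (use idx loadedD(3,4)[OF lds] uv in \<open>auto simp: exempt_def\<close>)
        fix s2
        assume 2: "(s2 vCov 0 \<noteq> 0 \<longleftrightarrow> exempt u v) \<and> s2 vX 0 = 1 + (u * n + v)"
          and fr2: "\<And>x. x \<notin> writes ?init \<Longrightarrow> s2 x = s x"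
        have s2: "s2 vDim 0 = d" "rep_entries X d (s2 aRep)" "s2 vNN 0 = n * n" "s2 vBad = s vBad"
          using sd fr2 loadedD(2)[OF lds] by auto
        let ?J = "\<lambda>i s. (s vCov 0 \<noteq> 0 \<longleftrightarrow> exempt u v \<or> (\<exists>i'<i. \<not> meets X i' u v)) \<and>
          s vX 0 = 1 + i * (n * n) + (u * n + v)"
        show "reaches (Seq (For vK vDim ?in) (Set vBad (Plus (Var vBad) (Minus (Lit 1) (Var vCov))))) s2
          ((d * (19 + 12) + 9) + 10) (?I (Suc (u * n + v)))"
        proof (rule reaches_Seq_frame)
          show "reaches (For vK vDim ?in) s2 (d * (19 + 12) + 9) (?J d)"
          proof (rule For_rule[where I = ?J])
            fix i s3
            assume i: "i < d" and fr3: "\<And>x. x \<noteq> vK \<Longrightarrow> x \<notin> writes ?in \<Longrightarrow> s3 x = s2 x"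
              and J: "?J i s3"
            have "s3 vNN 0 = n * n" "s3 aRep = s2 aRep" using s2 fr3 by auto
            \<comment> \<open>Entries are also zero on the diagonal; there the pair is exempt
              anyway, so counting such a zero as a separation does no harm.\<close>
            moreover have "exempt u v \<or> u \<noteq> v" by (auto simp: exempt_def)
            moreover have "s2 aRep (1 + i * (n * n) + (u * n + v)) = of_bool (u \<noteq> v \<and> meets X i u v)"
              using s2(2) i uv by (auto simp: rep_entries_def)
            ultimately show "reaches ?in s3 19 (?J (Suc i))"
              by (intro reaches_straight) (use J in \<open>auto simp: less_Suc_eq\<close>)
          qed (use 2 s2 in auto)
          fix s4
          assume 4: "?J d s4" and fr4: "\<And>x. x \<notin> writes (For vK vDim ?in) \<Longrightarrow> s4 x = s2 x"
          have "s4 vBad = s vBad" using s2 fr4 by auto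
          moreover have "(\<forall>u'<n. \<forall>v'<n. u' * n + v' < Suc (u * n + v) \<longrightarrow> ?P u' v') \<longleftrightarrow>
              (\<forall>u'<n. \<forall>v'<n. u' * n + v' < u * n + v \<longrightarrow> ?P u' v') \<and> ?P u v"
            using row_index_less_Suc[OF _ uv(2)] uv by metis
          ultimately show "reaches (Set vBad (Plus (Var vBad) (Minus (Lit 1) (Var vCov)))) s4 10
            (?I (Suc (u * n + v)))"
            by (intro reaches_straight) (use 4 I in auto)
        qed
      qed
    qed (use 1 loadedD(1)[OF ld1] n in auto)
  qed
  then show ?thesis
  proof (rule reaches_mono)
    show "3 + n * n * ((35 + ((d * (19 + 12) + 9) + 10)) + 51) \<le> n * n * (d * 40 + 150)"
    proof -
      have nn: "1 \<le> n * n" using n by auto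
      then have "3 \<le> d * (n * (n * 9)) + n * (n * 45)" by linarith
      then show ?thesis by (simp add: algebra_simps)
    qed
    fix s assume "?I (n * n) s"
    then show "s vBad 0 = 0 \<longleftrightarrow> covers d X"
      using row_index_less[of _ n _ n] by (auto simp: covers_def)
  qed
qed

end

section \<open>Enumerating the candidates\<close>

definition digit_value :: "nat \<Rightarrow> (nat \<Rightarrow> nat) \<Rightarrow> nat \<Rightarrow> nat" where
  "digit_value B X m = (\<Sum>j<m. X j * B ^ j)"

lemma digit_value_Suc [simp]: "digit_value B X (Suc m) = digit_value B X m + X m * B ^ m"
  by (simp add: digit_value_def)

lemma digit_value_0 [simp]: "digit_value B X 0 = 0"
  by (simp add: digit_value_def)

lemma digit_value_upd [simp]: "digit_value B (X(m := x)) m = digit_value B X m"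
  by (simp add: digit_value_def)

lemma digit_value_less: "(\<And>j. X j < B) \<Longrightarrow> digit_value B X m < B ^ m"
proof (induction m)
  case (Suc m)
  have "X m * B ^ m \<le> (B - 1) * B ^ m"
    using Suc.prems[of m] by (intro mult_right_mono) auto
  then have "digit_value B X (Suc m) < B ^ m + (B - 1) * B ^ m"
    unfolding digit_value_Suc by (rule add_less_le_mono[OF Suc.IH[OF Suc.prems]])
  also have "\<dots> = B ^ Suc m"
    using Suc.prems[of 0] by (cases B) auto
  finally show ?case .
qed simp

text \<open>The leading digit and the value of the lower ones are quotient and remainder modulo
  \<open>B ^ m\<close>; induction does the rest.\<close>

lemma digit_value_inj:
  assumes "\<And>j. X j < B" "\<And>j. Y j < B" "digit_value B X m = digit_value B Y m" "j < m"
  shows "X j = Y j"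
  using assms(3,4)
proof (induction m)
  case (Suc m)
  have less: "digit_value B X m < B ^ m" "digit_value B Y m < B ^ m"
    using digit_value_less assms(1,2) by blast+
  have "X m * B ^ m + digit_value B X m = Y m * B ^ m + digit_value B Y m"
    using Suc.prems(1) by (simp add: add.commute)
  then have "X m = Y m \<and> digit_value B X m = digit_value B Y m"
    using row_index_inj[OF less] by simp
  then show ?case using Suc by (auto simp: less_Suc_eq)
qed simp

text \<open>The number of a pair of a dimension and a digit string, in the order in which
  the search visits them.\<close>

definition position :: "nat \<Rightarrow> nat \<Rightarrow> (nat \<Rightarrow> nat) \<Rightarrow> nat" where
  "position B d X = (\<Sum>e<d. B ^ (e * B)) + digit_value B X (d * B)"

lemma position_less:
  "(\<And>j. X j < B) \<Longrightarrow> position B d X < (\<Sum>e<Suc d. B ^ (e * B))"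
  using digit_value_less[of X B "d * B"] by (simp add: position_def)

text \<open>The strings of dimension \<open>d\<close> occupy the interval of numbers between two
  consecutive partial sums, and these intervals are ordered like the dimensions.\<close>

lemma position_dim_mono:
  assumes "\<And>j. Y j < B" "position B d X \<le> position B e Y"
  shows "d \<le> e"
proof (rule ccontr)
  assume "\<not> d \<le> e"
  then have "(\<Sum>i<Suc e. B ^ (i * B)) \<le> (\<Sum>i<d. B ^ (i * B))"
    by (intro sum_mono2) auto
  also have "\<dots> \<le> position B d X" by (simp add: position_def)
  finally show False using position_less[of Y B e] assms by auto
qed

text \<open>Once the dimensions agree, digits below \<open>d * B\<close> agree by uniqueness of
  expansions, and beyond that both strings vanish. Full equality is what lets the search recognise
  its target.\<close>

lemma position_inj:
  assumes X: "\<And>j. X j < B" "\<And>j. d * B \<le> j \<Longrightarrow> X j = 0"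
    and Y: "\<And>j. Y j < B" "\<And>j. e * B \<le> j \<Longrightarrow> Y j = 0"
    and eq: "position B d X = position B e Y"
  shows "d = e \<and> X = Y"
proof -
  have "d \<le> e" by (rule position_dim_mono[of Y B d X e]) (use Y(1) eq in auto)
  moreover have "e \<le> d" by (rule position_dim_mono[of X B e Y d]) (use X(1) eq in auto)
  ultimately have de: "d = e" by simp
  have "X j = Y j" for j
  proof (cases "j < d * B")
    case True
    then show ?thesis
      using digit_value_inj[of X B Y "d * B" j] X(1) Y(1) eq de by (simp add: position_def)
  next
    case False
    then show ?thesis using X(2) Y(2) de by simp
  qed
  then show ?thesis using de by auto
qed

text \<open>Ripple carry at one digit: as long as the base minus the raised digit is positive the
  carry stops, otherwise the digit wraps to 0 and the carry moves on.\<close>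

definition inc_body :: prog where
  "inc_body = If (Var vCarry)
     (Seq (Assign aDig (Var vJ) (Plus (Cell aDig (Var vJ)) (Lit 1)))
          (If (Minus (Var vBase) (Cell aDig (Var vJ))) (Set vCarry (Lit 0)) (Assign aDig (Var vJ) (Lit 0))))
     Skip"

text \<open>A carry out of the last digit means that all digits have wrapped to 0, which is already
  the first string of the next dimension.\<close>

definition inc_prog :: prog where
  "inc_prog = Seq (Set vCarry (Lit 1)) (Seq (For vJ vLen inc_body)
     (If (Var vCarry) (Seq (Inc vDim) (Set vLen (Plus (Var vLen) (Var vBase)))) Skip))"

lemma writes_inc_body [simp]: "writes inc_body = {vCarry, aDig, vSkip}"
  by (auto simp: inc_body_def)

lemma writes_inc_prog [simp]: "writes inc_prog = {vCarry, aDig, vSkip, vJ, vDim, vLen}"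
  by (auto simp: inc_prog_def)

text \<open>The invariant is that of addition with carry: the value of the first \<open>j\<close>
  new digits plus the carry times \<open>B ^ j\<close> equals the old value plus 1.\<close>

lemma inc_spec:
  assumes s: "s0 aDig = X" "s0 vLen 0 = d * B" "s0 vBase 0 = B" "s0 vDim 0 = d"
    and X: "\<And>j. X j < B" "\<And>j. d * B \<le> j \<Longrightarrow> X j = 0"
  shows "reaches inc_prog s0 (d * B * 34 + 28) (\<lambda>s. \<exists>e. s vDim 0 = e \<and> s vLen 0 = e * B \<and>
    (\<forall>j. s aDig j < B) \<and> (\<forall>j \<ge> e * B. s aDig j = 0) \<and> position B e (s aDig) = Suc (position B d X))"
proof -
  let ?m = "d * B"
  let ?I = "\<lambda>j s. s vCarry 0 \<le> 1 \<and> (\<forall>x\<ge>j. s aDig x = X x) \<and> (\<forall>x. s aDig x < B) \<and>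
    digit_value B (s aDig) j + s vCarry 0 * B ^ j = digit_value B X j + 1"
  have "reaches inc_prog s0 (3 + ((?m * (22 + 12) + 9) + 16)) (\<lambda>s. \<exists>e. s vDim 0 = e \<and> s vLen 0 = e * B \<and>
    (\<forall>j. s aDig j < B) \<and> (\<forall>j \<ge> e * B. s aDig j = 0) \<and> position B e (s aDig) = Suc (position B d X))"
    unfolding inc_prog_def
  proof (rule reaches_Seq_frame)
    show "reaches (Set vCarry (Lit 1)) s0 3 (\<lambda>s. s vCarry 0 = 1)"
      by (rule reaches_straight) auto
    fix s1 assume 1: "s1 vCarry 0 = 1" and fr1: "\<And>x. x \<notin> writes (Set vCarry (Lit 1)) \<Longrightarrow> s1 x = s0 x"
    have s1: "s1 aDig = X" "s1 vLen 0 = ?m" "s1 vBase 0 = B" "s1 vDim 0 = d"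
      using s fr1 by auto
    show "reaches (Seq (For vJ vLen inc_body)
       (If (Var vCarry) (Seq (Inc vDim) (Set vLen (Plus (Var vLen) (Var vBase)))) Skip)) s1
       ((?m * (22 + 12) + 9) + 16) (\<lambda>s. \<exists>e. s vDim 0 = e \<and> s vLen 0 = e * B \<and>
      (\<forall>j. s aDig j < B) \<and> (\<forall>j \<ge> e * B. s aDig j = 0) \<and> position B e (s aDig) = Suc (position B d X))"
    proof (rule reaches_Seq_frame)
      show "reaches (For vJ vLen inc_body) s1 (?m * (22 + 12) + 9) (?I ?m)"
      proof (rule For_rule[where I = ?I])
        fix j s
        assume j: "j < ?m" and fr: "\<And>x. x \<noteq> vJ \<Longrightarrow> x \<notin> writes inc_body \<Longrightarrow> s x = s1 x"
          and sj: "s vJ 0 = j" and I: "?I j s"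
        have B: "s vBase 0 = B" using s1 fr by auto
        have Xj: "s aDig j = X j" "X j < B" "0 < B" using I X(1)[of j] by auto
        show "reaches inc_body s 22 (?I (Suc j))"
        proof (rule reaches_straight)
          consider "s vCarry 0 = 0" | "s vCarry 0 = 1" "Suc (X j) < B" | "s vCarry 0 = 1" "Suc (X j) = B"
            using I Xj by fastforce
          then show "?I (Suc j) (straight_run inc_body s)"
          proof cases
            case 1
            then have "straight_run inc_body s = s(vSkip := (s vSkip)(0 := 0))"
              by (simp add: inc_body_def)
            then show ?thesis using 1 I by auto
          next
            case 2
            then have "straight_run inc_body s =
              s(aDig := (s aDig)(j := Suc (X j)), vCarry := (s vCarry)(0 := 0))"
              using Xj sj B by (auto simp: inc_body_def)
            then show ?thesis using 2 I Xj by auto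
          next
            case 3
            then have "straight_run inc_body s = s(aDig := (s aDig)(j := 0))"
              using Xj sj B by (auto simp: inc_body_def)
            moreover have "B ^ j * B = B ^ j + X j * B ^ j" using 3(2) by auto
            ultimately show ?thesis using 3 I Xj by auto
          qed
        qed (auto simp: inc_body_def)
      qed (use 1 s1 X in auto)
      fix s2 assume 2: "?I ?m s2" and fr2: "\<And>x. x \<notin> writes (For vJ vLen inc_body) \<Longrightarrow> s2 x = s1 x"
      have s2: "s2 vLen 0 = ?m" "s2 vBase 0 = B" "s2 vDim 0 = d" using s1 fr2 by auto
      let ?last = "If (Var vCarry) (Seq (Inc vDim) (Set vLen (Plus (Var vLen) (Var vBase)))) Skip"
      have zero: "\<forall>j\<ge>?m. s2 aDig j = 0" using 2 X(2) by auto
      show "reaches ?last s2 16 (\<lambda>s. \<exists>e. s vDim 0 = e \<and> s vLen 0 = e * B \<and>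
        (\<forall>j. s aDig j < B) \<and> (\<forall>j \<ge> e * B. s aDig j = 0) \<and> position B e (s aDig) = Suc (position B d X))"
      proof (cases "s2 vCarry 0 = 0")
        case True
        have "straight_run ?last s2 = s2(vSkip := (s2 vSkip)(0 := 0))" using True by simp
        moreover have "position B d (s2 aDig) = Suc (position B d X)"
          using 2 True by (auto simp: position_def)
        ultimately show ?thesis
          by (intro reaches_straight) (use 2 s2 zero in auto)
      next
        case False
        then have c: "s2 vCarry 0 = 1" using 2 by auto
        have run: "straight_run ?last s2 = s2(vDim := (s2 vDim)(0 := Suc d), vLen := (s2 vLen)(0 := Suc d * B))"
          using c s2 by (simp add: add.commute)
        \<comment> \<open>The old value is below \<open>B ^ ?m\<close>, so an outgoing carry forces
          it to be the largest possible and the new value to be 0. Position numbers thus continue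
          without a gap into dimension \<open>Suc d\<close>.\<close>
        have val: "digit_value B (s2 aDig) ?m + B ^ ?m = digit_value B X ?m + 1" using 2 c by simp
        moreover have "digit_value B X ?m < B ^ ?m" using digit_value_less X(1) by blast
        ultimately have X_max: "digit_value B X ?m + 1 = B ^ ?m" "digit_value B (s2 aDig) ?m = 0"
          by auto
        have "s2 aDig j = 0" for j
        proof (cases "j < ?m")
          case True
          have "digit_value B (s2 aDig) ?m = digit_value B (\<lambda>_. 0) ?m"
            using X_max(2) by (simp add: digit_value_def)
          from digit_value_inj[OF _ _ this True] 2 X(1)[of 0] show ?thesis by auto
        next
          case False
          then show ?thesis using zero by auto
        qed
        then have z: "s2 aDig = (\<lambda>_. 0)" by auto
        have "position B (Suc d) (\<lambda>_. 0) = Suc (position B d X)"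
          using X_max(1) by (simp add: position_def digit_value_def)
        then have "\<exists>e. straight_run ?last s2 vDim 0 = e \<and> straight_run ?last s2 vLen 0 = e * B \<and>
          (\<forall>j. straight_run ?last s2 aDig j < B) \<and> (\<forall>j \<ge> e * B. straight_run ?last s2 aDig j = 0) \<and>
          position B e (straight_run ?last s2 aDig) = Suc (position B d X)"
          unfolding run using X(1)[of 0] by (simp add: z)
        then show ?thesis
          by (intro reaches_straight) auto
      qed
    qed
  qed
  then show ?thesis by (rule reaches_mono) auto
qed

definition test_prog :: prog where
  "test_prog = Seq gen_prog check_prog"

definition search_prog :: prog where
  "search_prog = Seq test_prog (While (Var vBad) (Seq inc_prog test_prog))"

lemma writes_test_prog [simp]:
  "writes test_prog = {vC, vPos, aLo, aHi, aL, aR, vSkip, vI, vJ, vW, vK, aRep, vQ, vCov, vX, vBad}"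
  by (auto simp: test_prog_def)

lemma writes_search_prog [simp]:
  "writes search_prog = {vC, vPos, aLo, aHi, aL, aR, vSkip, vI, vJ, vW, vK, aRep, vQ, vCov, vX, vBad,
     vCarry, aDig, vDim, vLen}"
  by (auto simp: search_prog_def)

context masked_graph
begin

lemma test_spec:
  assumes ld: "loaded s0" and n: "1 \<le> n" and X: "s0 aDig = X" and d: "s0 vDim 0 = d"
  shows "reaches test_prog s0 (n * n * (d * 340 + 170))
    (\<lambda>s. s vQ 0 = 1 + d * (n * n) \<and> rep_entries X d (s aRep) \<and> (s vBad 0 = 0 \<longleftrightarrow> covers d X))"
proof -
  have "reaches test_prog s0 (n * n * (d * 300 + 20) + n * n * (d * 40 + 150))
    (\<lambda>s. s vQ 0 = 1 + d * (n * n) \<and> rep_entries X d (s aRep) \<and> (s vBad 0 = 0 \<longleftrightarrow> covers d X))"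
    unfolding test_prog_def
  proof (rule reaches_Seq_frame[OF gen_spec[OF assms]])
    fix s1 assume 1: "s1 vQ 0 = 1 + d * (n * n) \<and> rep_entries X d (s1 aRep)"
      and fr1: "\<And>x. x \<notin> writes gen_prog \<Longrightarrow> s1 x = s0 x"
    have ld1: "loaded s1" by (subst loaded_cong[of _ s0]) (use ld fr1 in auto)
    have "reaches check_prog s1 (n * n * (d * 40 + 150)) (\<lambda>s. s vBad 0 = 0 \<longleftrightarrow> covers d X)"
      by (rule check_spec[OF ld1 n]) (use 1 fr1 d in auto)
    from reaches_frame[OF this]
    show "reaches check_prog s1 (n * n * (d * 40 + 150))
      (\<lambda>s. s vQ 0 = 1 + d * (n * n) \<and> rep_entries X d (s aRep) \<and> (s vBad 0 = 0 \<longleftrightarrow> covers d X))"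
      by (rule reaches_mono) (use 1 in auto)
  qed
  then show ?thesis by (rule reaches_mono) (auto simp: algebra_simps)
qed

text \<open>Each round raises the position by exactly 1, so it cannot jump over the position of
  \<open>Y\<close>, where the test succeeds. Up to that position no dimension exceeds
  \<open>D\<close>, which bounds both the result and the cost of every round.\<close>

lemma search_spec:
  assumes ld: "loaded s0" and n: "1 \<le> n"
    and s0: "s0 aDig = (\<lambda>_. 0)" "s0 vDim 0 = 0" "s0 vLen 0 = 0" "s0 vBase 0 = base"
    and Y: "\<And>j. Y j < base" "\<And>j. D * base \<le> j \<Longrightarrow> Y j = 0" "covers D Y"
  shows "reaches search_prog s0
    (n * n * 170 + (position base D Y * (D * base * 34 + 31 + n * n * (D * 340 + 170)) + 3))
    (\<lambda>s. \<exists>d X. d \<le> D \<and> covers d X \<and> s vDim 0 = d \<and> s vQ 0 = 1 + d * (n * n) \<and> rep_entries X d (s aRep))"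
proof -
  define T where "T = position base D Y"
  \<comment> \<open>One round: 3 for the guard and 28 plus a multiple of the length for the
    increment, then the test, all charged at the largest dimension \<open>D\<close>.\<close>
  define K where "K = D * base * 34 + 31 + n * n * (D * 340 + 170)"
  let ?Q = "\<lambda>s. \<exists>d X. d \<le> D \<and> covers d X \<and> s vDim 0 = d \<and> s vQ 0 = 1 + d * (n * n) \<and>
    rep_entries X d (s aRep)"
  let ?state = "\<lambda>s d X. loaded s \<and> s vBase 0 = base \<and> s vDim 0 = d \<and> s vLen 0 = d * base \<and> s aDig = X \<and>
    (\<forall>j. X j < base) \<and> (\<forall>j \<ge> d * base. X j = 0) \<and> position base d X \<le> T"
  let ?tested = "\<lambda>s d X. ?state s d X \<and> s vQ 0 = 1 + d * (n * n) \<and> rep_entries X d (s aRep) \<and>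
    (s vBad 0 = 0 \<longleftrightarrow> covers d X)"
  let ?W = "While (Var vBad) (Seq inc_prog test_prog)"
  have dim: "d \<le> D" if "position base d X \<le> T" for d X
    using position_dim_mono[OF Y(1)] that by (auto simp: T_def)
  have test: "reaches test_prog s (n * n * (d * 340 + 170)) (\<lambda>s'. ?tested s' d X)"
    if st: "?state s d X" for s d X
  proof -
    have "reaches test_prog s (n * n * (d * 340 + 170))
      (\<lambda>s. s vQ 0 = 1 + d * (n * n) \<and> rep_entries X d (s aRep) \<and> (s vBad 0 = 0 \<longleftrightarrow> covers d X))"
      by (rule test_spec) (use st n in auto)
    from reaches_frame[OF this] show ?thesis
    proof (rule reaches_mono)
      fix s' assume a: "(s' vQ 0 = 1 + d * (n * n) \<and> rep_entries X d (s' aRep) \<and>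
        (s' vBad 0 = 0 \<longleftrightarrow> covers d X)) \<and> (\<forall>x. x \<notin> writes test_prog \<longrightarrow> s' x = s x)"
      have "loaded s'" by (subst loaded_cong[of _ s]) (use st a in auto)
      then show "?tested s' d X" using a st by auto
    qed auto
  qed
  have loop: "reaches ?W s ((T - position base d X) * K + 3) ?Q" if "?tested s d X" for s d X
    using that
  proof (induction "T - position base d X" arbitrary: s d X rule: less_induct)
    case less
    show ?case
    proof (cases "covers d X")
      case True
      have "exec ?W s (1 + expr_cost (Var vBad)) s"
        by (rule exec.WhileFalse) (use less.prems True in auto)
      then show ?thesis
        by (rule reachesI) (use less.prems True dim in auto)
    next
      case False
      \<comment> \<open>At position \<open>T\<close> the current string would be \<open>Y\<close>
        itself, which covers.\<close>
      have "position base d X \<noteq> T"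
      proof
        assume "position base d X = T"
        then have "d = D \<and> X = Y"
          by (intro position_inj[of X base d Y D]) (use less.prems Y(1,2) T_def in auto)
        then show False using False Y(3) by simp
      qed
      then have lt: "position base d X < T" using less.prems by auto
      have d: "d \<le> D" using dim less.prems by auto
      have "reaches inc_prog s (d * base * 34 + 28) (\<lambda>s. \<exists>e. s vDim 0 = e \<and> s vLen 0 = e * base \<and>
        (\<forall>j. s aDig j < base) \<and> (\<forall>j \<ge> e * base. s aDig j = 0) \<and>
        position base e (s aDig) = Suc (position base d X))"
        by (rule inc_spec) (use less.prems in auto)
      from reaches_frame[OF this] obtain s1 u1 e where 1: "exec inc_prog s u1 s1" "u1 \<le> d * base * 34 + 28"
        "s1 vDim 0 = e" "s1 vLen 0 = e * base" "\<forall>j. s1 aDig j < base" "\<forall>j \<ge> e * base. s1 aDig j = 0"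
        "position base e (s1 aDig) = Suc (position base d X)"
        "\<forall>x. x \<notin> writes inc_prog \<longrightarrow> s1 x = s x"
        unfolding reaches_def by blast
      have "loaded s1" by (subst loaded_cong[of _ s]) (use less.prems 1 in auto)
      then have st1: "?state s1 e (s1 aDig)"
        using 1 less.prems lt by auto
      from test[OF this] obtain s2 u2 where 2: "exec test_prog s1 u2 s2" "u2 \<le> n * n * (e * 340 + 170)"
        "?tested s2 e (s1 aDig)"
        by (rule reachesE)
      have "reaches ?W s2 ((T - position base e (s1 aDig)) * K + 3) ?Q"
        by (rule less.hyps) (use 1 2 lt in auto)
      then obtain s3 u3 where 3: "exec ?W s2 u3 s3" "u3 \<le> (T - position base e (s1 aDig)) * K + 3" "?Q s3"
        by (rule reachesE)
      have "exec ?W s (1 + expr_cost (Var vBad) + (u1 + u2) + u3) s3"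
        by (rule exec.WhileTrue[OF _ exec.Seq[OF 1(1) 2(1)] 3(1)]) (use less.prems False in auto)
      moreover have "1 + expr_cost (Var vBad) + (u1 + u2) + u3 \<le> (T - position base d X) * K + 3"
      proof -
        have "e \<le> D" using dim st1 by auto
        have "d * base * 34 \<le> D * base * 34" using d by simp
        moreover have "n * n * (e * 340 + 170) \<le> n * n * (D * 340 + 170)"
          using \<open>e \<le> D\<close> by (intro mult_left_mono) auto
        ultimately have "3 + (u1 + u2) \<le> K" using 1(2) 2(2) unfolding K_def by linarith
        moreover have "T - position base d X = Suc (T - position base e (s1 aDig))"
          using 1(7) lt by simp
        ultimately show ?thesis using 3(2) by simp
      qed
      ultimately show ?thesis using 3(3) by (rule reachesI[where Q = ?Q and s' = s3])
    qed
  qed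
  have pos0: "position base 0 (\<lambda>_. 0) = 0" by (simp add: position_def)
  have "reaches search_prog s0 (n * n * (0 * 340 + 170) + (T * K + 3)) ?Q"
    unfolding search_prog_def
  proof (rule reaches_Seq)
    show "reaches test_prog s0 (n * n * (0 * 340 + 170)) (\<lambda>s. ?tested s 0 (\<lambda>_. 0))"
      by (rule test) (use ld s0 pos0 Y(1)[of 0] in auto)
    fix s assume "?tested s 0 (\<lambda>_. 0)"
    from loop[OF this] pos0 show "reaches ?W s (T * K + 3) ?Q" by simp
  qed
  then show ?thesis by (rule reaches_mono) (auto simp: T_def K_def)
qed

end

section \<open>Input and output\<close>

abbreviation mask_cell :: expr where
  "mask_cell \<equiv> Plus (Plus (Lit 1) (Var vNN)) (Var vI)"

definition copy_body :: prog where
  "copy_body = Seq (Assign aAdj (Var vI) (Cell 0 (Plus (Lit 1) (Var vI))))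
     (Assign 0 (Plus (Lit 1) (Var vI)) (Lit 0))"

definition mask_body :: prog where
  "mask_body = Seq (Assign aMask (Var vI) (Cell 0 mask_cell))
     (Seq (Assign 0 mask_cell (Lit 0)) (If (Cell aMask (Var vI)) Skip (Inc vCount)))"

text \<open>The counter is raised before the entry is stored because cell 0 of the new input holds
  the number of vertices.\<close>

definition pick_body :: prog where
  "pick_body = If (Plus (Cell aMask (Var vI)) (Cell aMask (Var vJ))) Skip
     (Seq (Inc vQ) (Assign 0 (Var vQ) (Cell aAdj (Var vW))))"

text \<open>Copying erases the source, as the given program expects zeros behind its shorter input.
  The square \<open>n * n\<close> arises by repeated addition, and \<open>vCount\<close> is the
  number of vertices outside the modulator.\<close>

definition setup_prog :: prog where
  "setup_prog = Seq (Set vN (Cell 0 (Lit 0)))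
     (Seq (For vI vN (Set vNN (Plus (Var vNN) (Var vN))))
     (Seq (For vI vNN copy_body)
     (Seq (For vI vN mask_body)
     (Seq (Assign 0 (Lit 0) (Var vCount))
          (For2 vI vJ vW vN pick_body)))))"

text \<open>Inverse of the compression: \<open>vY\<close> advances only at pairs outside the
  modulator, whose entries it reads off the small matrices in order. All other pairs get the entry
  of a universal vertex, 1 off the diagonal.\<close>

definition expand_body :: prog where
  "expand_body = Seq (If (Plus (Cell aMask (Var vI)) (Cell aMask (Var vJ)))
       (Assign aRep (Var vQ) (Minus (Lit 1) (Minus (Lit 1) absdiff)))
       (Seq (Assign aRep (Var vQ) (Cell 1 (Var vY))) (Inc vY)))
     (Inc vQ)"

definition expand_prog :: prog where
  "expand_prog = Seq (Set vY (Lit 1)) (For vK vGiven (For2 vI vJ vW vN expand_body))"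

text \<open>Array 1 holds the given representation until it has been expanded; the result is
  therefore assembled in \<open>aRep\<close> and copied at the end.\<close>

definition output_prog :: prog where
  "output_prog = Seq (Assign aRep (Lit 0) (Plus (Var vDim) (Var vGiven)))
     (For vI vQ (Assign 1 (Var vI) (Cell aRep (Var vI))))"

lemma writes_copy_body [simp]: "writes copy_body = {0, aAdj}"
  by (auto simp: copy_body_def)

lemma writes_mask_body [simp]: "writes mask_body = {0, aMask, vSkip, vCount}"
  by (auto simp: mask_body_def)

lemma writes_pick_body [simp]: "writes pick_body = {0, vSkip, vQ}"
  by (auto simp: pick_body_def)

lemma writes_setup_prog [simp]:
  "writes setup_prog = {0, vN, vNN, aAdj, aMask, vSkip, vCount, vQ, vI, vJ, vW}"
  by (auto simp: setup_prog_def)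

lemma writes_expand_body [simp]: "writes expand_body = {aRep, vY, vQ}"
  by (auto simp: expand_body_def)

lemma writes_expand_prog [simp]: "writes expand_prog = {aRep, vY, vQ, vK, vI, vJ, vW}"
  by (auto simp: expand_prog_def)

lemma writes_output_prog [simp]: "writes output_prog = {1, aRep, vI}"
  by (auto simp: output_prog_def)

lemma rk_compl: "rk M n + rk (\<lambda>v. \<not> M v) n = n"
  by (induction n) (auto simp: rk_Suc)

context masked_graph
begin

definition all_pairs :: "(nat \<times> nat) list" where
  "all_pairs = List.product [0..<n] [0..<n]"

definition free_pair :: "nat \<times> nat \<Rightarrow> bool" where
  "free_pair = (\<lambda>(u, v). \<not> M u \<and> \<not> M v)"

definition free_pairs :: "(nat \<times> nat) list" where
  "free_pairs = filter free_pair all_pairs"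

definition free_prefix :: "nat \<Rightarrow> (nat \<times> nat) list" where
  "free_prefix w = filter free_pair (take w all_pairs)"

lemma length_all_pairs [simp]: "length all_pairs = n * n"
  by (simp add: all_pairs_def)

lemma all_pairs_nth: "u < n \<Longrightarrow> v < n \<Longrightarrow> all_pairs ! (u * n + v) = (u, v)"
  using row_index_less[of u n v n] by (simp add: all_pairs_def product_nth)

lemma free_prefix_0 [simp]: "free_prefix 0 = []"
  by (simp add: free_prefix_def)

lemma free_prefix_all: "free_prefix (n * n) = free_pairs"
  by (simp add: free_prefix_def free_pairs_def)

lemma free_prefix_Suc:
  assumes "u < n" "v < n"
  shows "free_prefix (Suc (u * n + v)) =
    (if \<not> M u \<and> \<not> M v then free_prefix (u * n + v) @ [(u, v)] else free_prefix (u * n + v))"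
  using row_index_less[OF assms] all_pairs_nth[OF assms]
  by (simp add: free_prefix_def take_Suc_conv_app_nth free_pair_def)

text \<open>The number of free pairs seen before a free pair is its index in
  \<open>free_pairs\<close>, so a sequential counter points at the right entry.\<close>

lemma free_pairs_nth_prefix:
  assumes "u < n" "v < n" "\<not> M u" "\<not> M v"
  shows "length (free_prefix (u * n + v)) < length free_pairs"
    and "free_pairs ! length (free_prefix (u * n + v)) = (u, v)"
proof -
  let ?w = "u * n + v"
  have split: "all_pairs = take ?w all_pairs @ (u, v) # drop (Suc ?w) all_pairs"
    using row_index_less[OF assms(1,2)] all_pairs_nth[OF assms(1,2)] id_take_nth_drop[of ?w all_pairs]
    by simp
  have "free_pairs = free_prefix ?w @ (u, v) # filter free_pair (drop (Suc ?w) all_pairs)"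
    unfolding free_pairs_def free_prefix_def
    by (subst split) (use assms(3,4) in \<open>simp add: free_pair_def\<close>)
  then show "length (free_prefix ?w) < length free_pairs" "free_pairs ! length (free_prefix ?w) = (u, v)"
    by simp_all
qed

definition free_code :: "nat list" where
  "free_code = rk (\<lambda>v. \<not> M v) n # map (\<lambda>(u, v). of_bool (A u v)) free_pairs"

lemma pick_spec:
  assumes ld: "loaded s0" and n: "1 \<le> n" and q: "s0 vQ 0 = 0"
    and Z: "s0 0 = (\<lambda>x. if x = 0 then c else 0)"
  shows "reaches (For2 vI vJ vW vN pick_body) s0 (n * n * 71)
    (\<lambda>s. s 0 = (\<lambda>x. let L = c # map (\<lambda>(u, v). of_bool (A u v)) free_pairs in
      if x < length L then L ! x else 0))"
proof -
  let ?L = "\<lambda>w. c # map (\<lambda>(u, v). of_bool (A u v)) (free_prefix w)"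
  let ?I = "\<lambda>w s. s vQ 0 = length (free_prefix w) \<and>
    s 0 = (\<lambda>x. if x < length (?L w) then ?L w ! x else 0)"
  have "reaches (For2 vI vJ vW vN pick_body) s0 (n * n * (20 + 51)) (?I (n * n))"
  proof (rule For2_rule[where I = ?I])
    fix u v s
    assume uv: "u < n" "v < n"
      and fr: "\<And>x. x \<noteq> vI \<Longrightarrow> x \<noteq> vJ \<Longrightarrow> x \<noteq> vW \<Longrightarrow> x \<notin> writes pick_body \<Longrightarrow> s x = s0 x"
      and idx: "s vI 0 = u" "s vJ 0 = v" "s vW 0 = u * n + v" and I: "?I (u * n + v) s"
    have fr': "s aMask = s0 aMask" "s aAdj = s0 aAdj" using fr by auto
    have inp: "s aMask u = of_bool (M u)" "s aMask v = of_bool (M v)"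
      "s aAdj (u * n + v) = of_bool (A u v)"
      using loadedD[OF ld] uv fr' by auto
    let ?m = "length (free_prefix (u * n + v))"
    show "reaches pick_body s 20 (?I (Suc (u * n + v)))"
    proof (rule reaches_straight)
      show "?I (Suc (u * n + v)) (straight_run pick_body s)"
      proof (cases "M u \<or> M v")
        case True
        have "straight_run pick_body s = s(vSkip := (s vSkip)(0 := 0))"
          using True idx inp by (auto simp: pick_body_def)
        then show ?thesis
          using True I by (auto simp: free_prefix_Suc[OF uv])
      next
        case False
        have "straight_run pick_body s = s(vQ := (s vQ)(0 := Suc ?m),
          0 := (s 0)(Suc ?m := of_bool (A u v)))"
          using False idx inp I by (auto simp: pick_body_def)
        moreover have "(s 0)(Suc ?m := of_bool (A u v)) =
          (\<lambda>x. if x < length (?L (Suc (u * n + v))) then ?L (Suc (u * n + v)) ! x else 0)"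
          using I False
          by (auto simp: free_prefix_Suc[OF uv] fun_eq_iff nth_append nth_Cons' less_Suc_eq)
        ultimately show ?thesis
          using False I by (simp add: free_prefix_Suc[OF uv])
      qed
    qed (auto simp: pick_body_def)
  qed (use q Z loadedD(1)[OF ld] n in \<open>auto simp: fun_eq_iff\<close>)
  then show ?thesis
    by (rule reaches_mono) (auto simp: free_prefix_all Let_def)
qed

lemma setup_spec:
  assumes n: "1 \<le> n"
    and Z: "s0 0 0 = n" "\<And>u v. u < n \<Longrightarrow> v < n \<Longrightarrow> s0 0 (1 + (u * n + v)) = of_bool (A u v)"
      "\<And>v. v < n \<Longrightarrow> s0 0 (1 + n * n + v) = of_bool (M v)" "\<And>x. n * n + n < x \<Longrightarrow> s0 0 x = 0"
    and zero: "\<And>a. a \<noteq> 0 \<Longrightarrow> s0 a = (\<lambda>_. 0)"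
  shows "reaches setup_prog s0 (n * n * 200)
    (\<lambda>s. loaded s \<and> s vCount 0 = rk (\<lambda>v. \<not> M v) n \<and>
      s 0 = (\<lambda>x. if x < length free_code then free_code ! x else 0))"
proof -
  let ?Q = "\<lambda>s. loaded s \<and> s vCount 0 = rk (\<lambda>v. \<not> M v) n \<and>
      s 0 = (\<lambda>x. if x < length free_code then free_code ! x else 0)"
  have "reaches setup_prog s0 (4 + ((n * (7 + 12) + 9) + ((n * n * (14 + 12) + 9) +
    ((n * (30 + 12) + 9) + (4 + n * n * 71))))) ?Q"
    unfolding setup_prog_def
  proof (rule reaches_Seq_frame)
    show "reaches (Set vN (Cell 0 (Lit 0))) s0 4 (\<lambda>s. s vN 0 = n)"
      by (rule reaches_straight) (use Z in auto)
    fix s1 assume 1: "s1 vN 0 = n" and fr1: "\<And>x. x \<notin> writes (Set vN (Cell 0 (Lit 0))) \<Longrightarrow> s1 x = s0 x"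
    let ?sq = "Set vNN (Plus (Var vNN) (Var vN))"
    show "reaches (Seq (For vI vN ?sq) (Seq (For vI vNN copy_body)
      (Seq (For vI vN mask_body) (Seq (Assign 0 (Lit 0) (Var vCount)) (For2 vI vJ vW vN pick_body))))) s1
      ((n * (7 + 12) + 9) + ((n * n * (14 + 12) + 9) + ((n * (30 + 12) + 9) + (4 + n * n * 71)))) ?Q"
    proof (rule reaches_Seq_frame)
      let ?I = "\<lambda>j s. s vNN 0 = j * n"
      show "reaches (For vI vN ?sq) s1 (n * (7 + 12) + 9) (?I n)"
      proof (rule For_rule[where I = ?I])
        fix j s assume "\<And>x. x \<noteq> vI \<Longrightarrow> x \<notin> writes ?sq \<Longrightarrow> s x = s1 x" "?I j s"
        then show "reaches ?sq s 7 (?I (Suc j))"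
          using 1 by (intro reaches_straight) auto
      qed (use 1 fr1 zero in auto)
      fix s2 assume 2: "?I n s2" and fr2: "\<And>x. x \<notin> writes (For vI vN ?sq) \<Longrightarrow> s2 x = s1 x"
      have s2: "s2 0 = s0 0" "s2 vN 0 = n" using 1 fr1 fr2 by auto
      have fr02: "s2 x = (\<lambda>_. 0)" if "x \<notin> {0, vN, vNN, vI}" for x
        using zero[of x] fr1[of x] fr2[of x] that by auto
      show "reaches (Seq (For vI vNN copy_body)
        (Seq (For vI vN mask_body) (Seq (Assign 0 (Lit 0) (Var vCount)) (For2 vI vJ vW vN pick_body)))) s2
        ((n * n * (14 + 12) + 9) + ((n * (30 + 12) + 9) + (4 + n * n * 71))) ?Q"
      proof (rule reaches_Seq_frame)
        let ?I = "\<lambda>j s. (\<forall>x<j. s aAdj x = s0 0 (1 + x)) \<and>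
          (\<forall>x. s 0 x = (if 1 \<le> x \<and> x \<le> j then 0 else s0 0 x))"
        show "reaches (For vI vNN copy_body) s2 (n * n * (14 + 12) + 9) (?I (n * n))"
        proof (rule For_rule[where I = ?I])
          fix j s assume "s vI 0 = j" "?I j s"
          then show "reaches copy_body s 14 (?I (Suc j))"
            by (intro reaches_straight) (auto simp: copy_body_def less_Suc_eq)
        qed (use 2 s2 in auto)
        fix s3 assume 3: "?I (n * n) s3" and fr3: "\<And>x. x \<notin> writes (For vI vNN copy_body) \<Longrightarrow> s3 x = s2 x"
        have s3: "s3 vN 0 = n" "s3 vNN 0 = n * n" "s3 vCount 0 = 0" "s3 vQ 0 = 0"
          using s2 2 fr3 fr02 by auto
        have adj3: "s3 aAdj (u * n + v) = of_bool (A u v)" if "u < n" "v < n" for u v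
          using 3 Z(2)[OF that] row_index_less[OF that] by auto
        have mask3: "s3 0 (Suc (n * n + v)) = of_bool (M v)" if "v < n" for v
          using 3 Z(3)[OF that] by auto
        show "reaches (Seq (For vI vN mask_body)
          (Seq (Assign 0 (Lit 0) (Var vCount)) (For2 vI vJ vW vN pick_body))) s3
          ((n * (30 + 12) + 9) + (4 + n * n * 71)) ?Q"
        proof (rule reaches_Seq_frame)
          let ?I = "\<lambda>j s. (\<forall>v<j. s aMask v = of_bool (M v)) \<and> s vCount 0 = rk (\<lambda>v. \<not> M v) j \<and>
            (\<forall>x. s 0 x = (if x = 0 then n else if x \<le> n * n + j then 0 else s0 0 x))"
          show "reaches (For vI vN mask_body) s3 (n * (30 + 12) + 9) (?I n)"
          proof (rule For_rule[where I = ?I])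
            fix j s assume j: "j < n" "s vI 0 = j" and I: "?I j s"
              and fr: "\<And>x. x \<noteq> vI \<Longrightarrow> x \<notin> writes mask_body \<Longrightarrow> s x = s3 x"
            have "s vNN 0 = n * n" using fr s3 by auto
            moreover have "s 0 (Suc (n * n + j)) = of_bool (M j)"
              using I Z(3)[OF j(1)] by auto
            ultimately show "reaches mask_body s 30 (?I (Suc j))"
              by (intro reaches_straight)
                (use I j in \<open>auto simp: mask_body_def less_Suc_eq rk_Suc le_Suc_eq\<close>)
          qed (use 3 s3 Z(1) in auto)
          fix s4 assume 4: "?I n s4" and fr4: "\<And>x. x \<notin> writes (For vI vN mask_body) \<Longrightarrow> s4 x = s3 x"
          have "s4 aAdj = s3 aAdj" "s4 vN = s3 vN" "s4 vNN = s3 vNN" using fr4 by auto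
          then have ld4: "loaded s4" using 4 s3 adj3 by (auto simp: loaded_def)
          let ?c = "rk (\<lambda>v. \<not> M v) n"
          \<comment> \<open>The loops have cleared cells 1 to \<open>n * n + n\<close>, and the
            input was zero beyond.\<close>
          have z4: "(s4 0)(0 := ?c) = (\<lambda>x. if x = 0 then ?c else 0)"
            using 4 Z(4) by (auto simp: fun_eq_iff)
          show "reaches (Seq (Assign 0 (Lit 0) (Var vCount)) (For2 vI vJ vW vN pick_body)) s4
            (4 + n * n * 71) ?Q"
          proof (rule reaches_Seq_frame)
            show "reaches (Assign 0 (Lit 0) (Var vCount)) s4 4 (\<lambda>s. s 0 = (\<lambda>x. if x = 0 then ?c else 0))"
              by (rule reaches_straight) (use 4 z4 in auto)
            fix s5 assume 5: "s5 0 = (\<lambda>x. if x = 0 then ?c else 0)"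
              and fr5: "\<And>x. x \<notin> writes (Assign 0 (Lit 0) (Var vCount)) \<Longrightarrow> s5 x = s4 x"
            have ld5: "loaded s5" by (subst loaded_cong[of _ s4]) (use ld4 fr5 in auto)
            have s5: "s5 vQ 0 = 0" "s5 vCount 0 = ?c" using s3 4 fr4 fr5 by auto
            from reaches_frame[OF pick_spec[OF ld5 n s5(1) 5]]
            show "reaches (For2 vI vJ vW vN pick_body) s5 (n * n * 71) ?Q"
            proof (rule reaches_mono)
              fix s6
              assume 6: "s6 0 = (\<lambda>x. let L = ?c # map (\<lambda>(u, v). of_bool (A u v)) free_pairs in
                  if x < length L then L ! x else 0) \<and>
                (\<forall>x. x \<notin> writes (For2 vI vJ vW vN pick_body) \<longrightarrow> s6 x = s5 x)"
              have "loaded s6" by (subst loaded_cong[of _ s5]) (use ld5 6 in auto)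
              then show "?Q s6" using 6 s5 by (auto simp: free_code_def Let_def)
            qed auto
          qed
        qed
      qed
    qed
  qed
  then show ?thesis
  proof (rule reaches_mono)
    have "n \<le> n * n" "1 \<le> n * n" using n by auto
    then have "61 * n + 35 \<le> 103 * (n * n)" by linarith
    then show "4 + ((n * (7 + 12) + 9) + ((n * n * (14 + 12) + 9) +
      ((n * (30 + 12) + 9) + (4 + n * n * 71)))) \<le> n * n * 200" by simp
  qed auto
qed

lemma expand_inner_spec:
  assumes ld: "loaded s0" and n: "1 \<le> n" and q: "s0 vQ 0 = q" and y: "s0 vY 0 = y"
    and e: "\<And>t. t < length free_pairs \<Longrightarrow> s0 1 (y + t) = e (free_pairs ! t)"
  shows "reaches (For2 vI vJ vW vN expand_body) s0 (n * n * 83)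
    (\<lambda>s. s vQ 0 = q + n * n \<and> s vY 0 = y + length free_pairs \<and> (\<forall>x<q. s aRep x = s0 aRep x) \<and>
      (\<forall>u<n. \<forall>v<n. s aRep (q + (u * n + v)) = (if M u \<or> M v then of_bool (u \<noteq> v) else e (u, v))))"
proof -
  let ?e = "\<lambda>u v. if M u \<or> M v then of_bool (u \<noteq> v) else e (u, v)"
  let ?I = "\<lambda>w s. s vQ 0 = q + w \<and> s vY 0 = y + length (free_prefix w) \<and>
    (\<forall>x<q. s aRep x = s0 aRep x) \<and>
    (\<forall>u<n. \<forall>v<n. u * n + v < w \<longrightarrow> s aRep (q + (u * n + v)) = ?e u v)"
  have "reaches (For2 vI vJ vW vN expand_body) s0 (n * n * (32 + 51)) (?I (n * n))"
  proof (rule For2_rule[where I = ?I])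
    fix u v s
    assume uv: "u < n" "v < n"
      and fr: "\<And>x. x \<noteq> vI \<Longrightarrow> x \<noteq> vJ \<Longrightarrow> x \<noteq> vW \<Longrightarrow> x \<notin> writes expand_body \<Longrightarrow> s x = s0 x"
      and idx: "s vI 0 = u" "s vJ 0 = v" "s vW 0 = u * n + v" and I: "?I (u * n + v) s"
    have fr': "s aMask = s0 aMask" "s 1 = s0 1" using fr by auto
    have inp: "s aMask u = of_bool (M u)" "s aMask v = of_bool (M v)"
      using loadedD[OF ld] uv fr' by auto
    let ?m = "length (free_prefix (u * n + v))"
    show "reaches expand_body s 32 (?I (Suc (u * n + v)))"
    proof (rule reaches_straight)
      show "?I (Suc (u * n + v)) (straight_run expand_body s)"
      proof (cases "M u \<or> M v")
        case True
        have "straight_run expand_body s = s(aRep := (s aRep)(q + (u * n + v) := ?e u v),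
          vQ := (s vQ)(0 := q + Suc (u * n + v)))"
          using True idx inp I by (auto simp: expand_body_def)
        then show ?thesis
          using True I uv by (auto simp: free_prefix_Suc row_index_less_Suc row_index_inj)
      next
        case False
        have "s 1 (y + ?m) = e (u, v)"
          using False e[of ?m] free_pairs_nth_prefix[OF uv] fr' by auto
        then have "straight_run expand_body s = s(aRep := (s aRep)(q + (u * n + v) := ?e u v),
          vY := (s vY)(0 := y + Suc ?m), vQ := (s vQ)(0 := q + Suc (u * n + v)))"
          using False idx inp I by (auto simp: expand_body_def)
        then show ?thesis
          using False I uv by (auto simp: free_prefix_Suc row_index_less_Suc row_index_inj)
      qed
    qed (auto simp: expand_body_def)
  qed (use q y loadedD(1)[OF ld] n in auto)
  then show ?thesis
    by (rule reaches_mono) (use row_index_less[of _ n _ n] in \<open>auto simp: free_prefix_all\<close>)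
qed

lemma expand_spec:
  assumes ld: "loaded s0" and n: "1 \<le> n" and q: "s0 vQ 0 = q" and b: "s0 vGiven 0 = b"
    and e: "\<And>i t. i < b \<Longrightarrow> t < length free_pairs \<Longrightarrow>
      s0 1 (1 + i * length free_pairs + t) = e i (free_pairs ! t)"
  shows "reaches expand_prog s0 (n * n * (b * 95 + 12))
    (\<lambda>s. s vQ 0 = q + b * (n * n) \<and> (\<forall>x<q. s aRep x = s0 aRep x) \<and>
      (\<forall>i<b. \<forall>u<n. \<forall>v<n. s aRep (q + i * (n * n) + (u * n + v)) =
        (if M u \<or> M v then of_bool (u \<noteq> v) else e i (u, v))))"
proof -
  let ?e = "\<lambda>i u v. if M u \<or> M v then of_bool (u \<noteq> v) else e i (u, v)"
  let ?I = "\<lambda>j s. s vQ 0 = q + j * (n * n) \<and> s vY 0 = 1 + j * length free_pairs \<and>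
    (\<forall>x<q. s aRep x = s0 aRep x) \<and>
    (\<forall>i<j. \<forall>u<n. \<forall>v<n. s aRep (q + i * (n * n) + (u * n + v)) = ?e i u v)"
  let ?body = "For2 vI vJ vW vN expand_body"
  have "reaches expand_prog s0 (3 + (b * (n * n * 83 + 12) + 9)) (?I b)"
    unfolding expand_prog_def
  proof (rule reaches_Seq_frame)
    show "reaches (Set vY (Lit 1)) s0 3 (\<lambda>s. s vY 0 = 1)"
      by (rule reaches_straight) auto
    fix s1 assume 1: "s1 vY 0 = 1" and fr1: "\<And>x. x \<notin> writes (Set vY (Lit 1)) \<Longrightarrow> s1 x = s0 x"
    have ld1: "loaded s1" by (subst loaded_cong[of _ s0]) (use ld fr1 in auto)
    show "reaches (For vK vGiven ?body) s1 (b * (n * n * 83 + 12) + 9) (?I b)"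
    proof (rule For_rule[where I = ?I])
      fix j s
      assume j: "j < b" and fr: "\<And>x. x \<noteq> vK \<Longrightarrow> x \<notin> writes ?body \<Longrightarrow> s x = s1 x" and I: "?I j s"
      have lds: "loaded s" by (subst loaded_cong[of _ s1]) (use ld1 fr in auto)
      have s1: "s 1 = s0 1" using fr fr1 by auto
      have "reaches ?body s (n * n * 83)
        (\<lambda>s'. s' vQ 0 = q + j * (n * n) + n * n \<and> s' vY 0 = 1 + j * length free_pairs + length free_pairs \<and>
          (\<forall>x<q + j * (n * n). s' aRep x = s aRep x) \<and>
          (\<forall>u<n. \<forall>v<n. s' aRep (q + j * (n * n) + (u * n + v)) = ?e j u v))"
        by (rule expand_inner_spec[OF lds n]) (use I s1 e[OF j] in auto)
      then show "reaches ?body s (n * n * 83) (?I (Suc j))"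
      proof (rule reaches_mono)
        fix s'
        assume a: "s' vQ 0 = q + j * (n * n) + n * n \<and>
          s' vY 0 = 1 + j * length free_pairs + length free_pairs \<and>
          (\<forall>x<q + j * (n * n). s' aRep x = s aRep x) \<and>
          (\<forall>u<n. \<forall>v<n. s' aRep (q + j * (n * n) + (u * n + v)) = ?e j u v)"
        have old: "q + i * (n * n) + (u * n + v) < q + j * (n * n)" if "i < j" "u < n" "v < n" for i u v
          using row_index_less[OF that(1), of "u * n + v" "n * n"] row_index_less[OF that(2,3)] by simp
        have "s' aRep (q + i * (n * n) + (u * n + v)) = ?e i u v"
          if "i < Suc j" "u < n" "v < n" for i u v
        proof (cases "i = j")
          case False
          then have "i < j" using that by simp
          have "s' aRep (q + i * (n * n) + (u * n + v)) = s aRep (q + i * (n * n) + (u * n + v))"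
            using a old[OF \<open>i < j\<close> that(2,3)] by blast
          then show ?thesis using I \<open>i < j\<close> that by simp
        qed (use a that in auto)
        moreover have "s' aRep x = s0 aRep x" if "x < q" for x
          using a I that by auto
        ultimately show "?I (Suc j) s'" using a by auto
      qed auto
    qed (use 1 fr1 q b in auto)
  qed
  then show ?thesis
  proof (rule reaches_mono)
    have nn: "1 \<le> n * n" using n by auto
    have "12 * b + 12 \<le> 12 * (n * n * b) + 12 * (n * n)"
      using mult_le_mono1[OF nn, of b] nn by linarith
    then show "3 + (b * (n * n * 83 + 12) + 9) \<le> n * n * (b * 95 + 12)" by (simp add: algebra_simps)
  qed auto
qed

end

lemma output_spec:
  assumes "s0 vQ 0 = q" "0 < q" "s0 vDim 0 = d" "s0 vGiven 0 = b"
  shows "reaches output_prog s0 (q * 18 + 16)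
    (\<lambda>s. s 1 0 = d + b \<and> (\<forall>x. 0 < x \<and> x < q \<longrightarrow> s 1 x = s0 aRep x))"
proof -
  let ?f = "(s0 aRep)(0 := d + b)"
  let ?I = "\<lambda>j s. \<forall>x<j. s 1 x = ?f x"
  have "reaches output_prog s0 (7 + (q * (6 + 12) + 9)) (?I q)"
    unfolding output_prog_def
  proof (rule reaches_Seq_frame)
    show "reaches (Assign aRep (Lit 0) (Plus (Var vDim) (Var vGiven))) s0 7 (\<lambda>s. s aRep = ?f)"
      by (rule reaches_straight) (use assms in auto)
    fix s1 assume 1: "s1 aRep = ?f"
      and fr: "\<And>x. x \<notin> writes (Assign aRep (Lit 0) (Plus (Var vDim) (Var vGiven))) \<Longrightarrow> s1 x = s0 x"
    let ?body = "Assign 1 (Var vI) (Cell aRep (Var vI))"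
    show "reaches (For vI vQ ?body) s1 (q * (6 + 12) + 9) (?I q)"
    proof (rule For_rule[where I = ?I])
      fix j s assume j: "s vI 0 = j" "?I j s"
        and fr': "\<And>x. x \<noteq> vI \<Longrightarrow> x \<notin> writes ?body \<Longrightarrow> s x = s1 x"
      have "s aRep = ?f" using fr' 1 by auto
      then show "reaches ?body s 6 (?I (Suc j))"
        by (intro reaches_straight) (use j in \<open>auto simp: less_Suc_eq\<close>)
    qed (use assms fr in auto)
  qed
  then show ?thesis
    by (rule reaches_mono) (use assms in auto)
qed

section \<open>The whole program\<close>

lemma product_filter:
  "List.product (filter P xs) (filter Q ys) = filter (\<lambda>(x, y). P x \<and> Q y) (List.product xs ys)"
  by (induction xs) (auto simp: filter_map o_def)

lemma product_map:
  "List.product (map f xs) (map g ys) = map (\<lambda>(x, y). (f x, g y)) (List.product xs ys)"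
  by (induction xs) auto

lemma concat_map_product:
  "concat (map (\<lambda>x. map (f x) ys) xs) = map (\<lambda>(x, y). f x y) (List.product xs ys)"
  by (induction xs) auto

lemma adj_matrix_product:
  "adj_matrix vs G = map (\<lambda>(x, y). of_bool ({x, y} \<in> edges G)) (List.product vs vs)"
  unfolding adj_matrix_def concat_map_product ..

lemma length_adj_matrix [simp]: "length (adj_matrix vs G) = length vs * length vs"
  by (simp add: adj_matrix_product)

lemma adj_matrix_nth:
  assumes "u < length vs" "v < length vs"
  shows "adj_matrix vs G ! (u * length vs + v) = of_bool ({vs ! u, vs ! v} \<in> edges G)"
  using row_index_less[OF assms] row_index_div_mod[OF assms(2), of u]
  by (simp add: adj_matrix_product product_nth)

lemma concat_nth_uniform:
  assumes "\<And>xs. xs \<in> set xss \<Longrightarrow> length xs = m" "i < length xss" "t < m"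
  shows "concat xss ! (i * m + t) = xss ! i ! t"
  using assms
proof (induction xss arbitrary: i)
  case (Cons xs xss)
  then show ?case by (cases i) (auto simp: nth_append)
qed simp

lemma length_concat_uniform:
  "(\<And>xs. xs \<in> set xss \<Longrightarrow> length xs = m) \<Longrightarrow> length (concat xss) = length xss * m"
  by (induction xss) auto

lemma length_rep_code: "length (rep_code vs Is) = 1 + length Is * (length vs * length vs)"
  unfolding rep_code_def by (simp, subst length_concat_uniform[where m = "length vs * length vs"]) auto

lemma rep_code_nth:
  assumes "i < length Is" "t < length vs * length vs"
  shows "rep_code vs Is ! (1 + i * (length vs * length vs) + t) = adj_matrix vs (Is ! i) ! t"
  unfolding rep_code_def using assms
  by (simp, subst concat_nth_uniform[where m = "length vs * length vs"]) auto

lemma rep_code_0: "rep_code vs Is ! 0 = length Is"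
  by (simp add: rep_code_def)

text \<open>\<open>vN - vCount\<close> is the size of the modulator, added twice in place of
  doubling. The bound \<open>b\<close> is a constant of the program.\<close>

definition mid_prog :: "nat \<Rightarrow> prog" where
  "mid_prog b = Seq (Set vBase (Plus (Lit 1) (Plus (Minus (Var vN) (Var vCount)) (Minus (Var vN) (Var vCount)))))
     (Set vGiven (Lit b))"

lemma writes_mid_prog [simp]: "writes (mid_prog b) = {vBase, vGiven}"
  by (auto simp: mid_prog_def)

text \<open>Moves the working arrays of the given program out of the way of those used here.\<close>

definition shift :: "nat \<Rightarrow> nat" where
  "shift a = (if a < 2 then a else a + 30)"

lemma inj_shift: "inj shift"
proof (rule injI)
  show "a = b" if "shift a = shift b" for a b
    using that unfolding shift_def by presburger
qed

definition full_prog :: "nat \<Rightarrow> prog \<Rightarrow> prog" where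
  "full_prog b p = Seq setup_prog (Seq (rename shift p) (Seq (mid_prog b)
     (Seq search_prog (Seq expand_prog output_prog))))"

context enumerated_graph
begin

definition free_verts :: "'a list" where
  "free_verts = filter (\<lambda>x. x \<notin> S) vs"

lemma length_free_verts: "length free_verts = rk (\<lambda>v. \<not> M v) n"
  unfolding free_verts_def length_filter_conv_card rk_def n_def M_def by simp

text \<open>Filtering commutes with products, so a row-major sweep of the small matrix is a
  subsequence of the sweep of the large one.\<close>

lemma product_free_verts:
  "List.product free_verts free_verts = map (\<lambda>(u, v). (vs ! u, vs ! v)) free_pairs"
proof -
  have vs: "vs = map ((!) vs) [0..<n]" by (simp add: n_def map_nth)
  have "List.product vs vs = map (\<lambda>(u, v). (vs ! u, vs ! v)) all_pairs"
    unfolding all_pairs_def product_map[symmetric] vs[symmetric] ..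
  then show ?thesis
    unfolding free_verts_def product_filter
    by (simp add: filter_map free_pairs_def free_pair_def M_def o_def case_prod_unfold)
qed

lemma adj_matrix_free_verts:
  "adj_matrix free_verts H = map (\<lambda>(u, v). of_bool ({vs ! u, vs ! v} \<in> edges H)) free_pairs"
  unfolding adj_matrix_product product_free_verts by (simp add: case_prod_unfold)

text \<open>One matrix, its length read in two ways.\<close>

lemma length_free_pairs: "length free_pairs = length free_verts * length free_verts"
proof -
  have "length (adj_matrix free_verts G) = length free_pairs"
    unfolding adj_matrix_free_verts by simp
  then show ?thesis by simp
qed

lemma free_code: "free_code = graph_code free_verts (delete_verts G S)"
proof -
  have "map (\<lambda>(u, v). of_bool (A u v)) free_pairs =
    map (\<lambda>(u, v). of_bool ({vs ! u, vs ! v} \<in> edges (delete_verts G S))) free_pairs"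
    by (rule map_cong) (auto simp: free_pairs_def free_pair_def A_def M_def delete_verts_def)
  then show ?thesis
    by (simp add: free_code_def graph_code_def length_free_verts adj_matrix_free_verts)
qed

lemma enumerates_free_verts: "enumerates free_verts (verts (delete_verts G S))"
  using enum by (auto simp: enumerates_def free_verts_def delete_verts_def)

lemma graph_set_code_entries:
  defines "Z \<equiv> init_store (graph_set_code vs G S)"
  shows "Z 0 0 = n"
    and "\<And>u v. u < n \<Longrightarrow> v < n \<Longrightarrow> Z 0 (1 + (u * n + v)) = of_bool (A u v)"
    and "\<And>v. v < n \<Longrightarrow> Z 0 (1 + n * n + v) = of_bool (M v)"
    and "\<And>x. n * n + n < x \<Longrightarrow> Z 0 x = 0"
    and "\<And>a. a \<noteq> 0 \<Longrightarrow> Z a = (\<lambda>_. 0)"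
proof -
  have code: "graph_set_code vs G S = n # adj_matrix vs G @ map (\<lambda>v. of_bool (v \<in> S)) vs"
    by (simp add: graph_set_code_def graph_code_def n_def)
  have len: "length (graph_set_code vs G S) = Suc (n * n + n)"
    by (simp add: code n_def)
  show "Z 0 0 = n" by (simp add: Z_def init_store_def code)
  show "Z 0 (1 + (u * n + v)) = of_bool (A u v)" if "u < n" "v < n" for u v
    using row_index_less[OF that] that adj_matrix_nth[of u vs v G]
    by (auto simp: Z_def init_store_def code n_def nth_append A_def)
  show "Z 0 (1 + n * n + v) = of_bool (M v)" if "v < n" for v
    using that by (auto simp: Z_def init_store_def code n_def nth_append M_def)
  show "Z 0 x = 0" if "n * n + n < x" for x
    using that by (auto simp: Z_def init_store_def len)
  show "Z a = (\<lambda>_. 0)" if "a \<noteq> 0" for a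
    using that by (auto simp: Z_def init_store_def)
qed

lemma extend_graph_edge_iff:
  assumes "box_representation (delete_verts G S) Is" "I \<in> set Is" "u < n" "v < n"
  shows "{vs ! u, vs ! v} \<in> edges (extend_graph (verts G) S I) \<longleftrightarrow>
    (if M u \<or> M v then u \<noteq> v else {vs ! u, vs ! v} \<in> edges I)"
proof -
  have "edges I \<subseteq> vertex_pairs (verts G - S)"
    using delete_verts_representation_graphs[OF assms(1,2)]
    by (auto simp: interval_graph_def simple_graph_def)
  then have "\<not> M u \<and> \<not> M v" if "{vs ! u, vs ! v} \<in> edges I"
    using that by (auto simp: vertex_pairs_iff M_def)
  then show ?thesis
    using assms(3,4) nth_in_verts nth_eq_iff by (auto simp: extend_graph_def vertex_pairs_iff M_def)
qed

lemma full_prog_spec: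
  assumes n: "1 \<le> n"
    and rep: "box_representation (delete_verts G S) Is" "length Is = b"
    and p: "runs p (graph_code free_verts (delete_verts G S)) tp (rep_code free_verts Is)"
    and Y: "\<And>j. Y j < base" "\<And>j. D * base \<le> j \<Longrightarrow> Y j = 0" "covers D Y"
  shows "\<exists>\<B> t. box_representation G \<B> \<and> length \<B> \<le> D + b \<and>
    runs (full_prog b p) (graph_set_code vs G S) t (rep_code vs \<B>) \<and>
    t \<le> n * n * 200 + (tp + (18 + ((n * n * 170 +
      (position base D Y * (D * base * 34 + 31 + n * n * (D * 340 + 170)) + 3)) +
      (n * n * (b * 95 + 12) + ((1 + (D + b) * (n * n)) * 18 + 16)))))"
proof -
  let ?s0 = "init_store (graph_set_code vs G S)"
  let ?c = "rk (\<lambda>v. \<not> M v) n"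
  have "reaches setup_prog ?s0 (n * n * 200) (\<lambda>s. loaded s \<and> s vCount 0 = ?c \<and>
      s 0 = (\<lambda>x. if x < length free_code then free_code ! x else 0))"
    by (rule setup_spec) (fact n graph_set_code_entries)+
  from reaches_frame[OF this]
  obtain s1 t1 where 1: "exec setup_prog ?s0 t1 s1" "t1 \<le> n * n * 200" "loaded s1" "s1 vCount 0 = ?c"
    "s1 0 = (\<lambda>x. if x < length free_code then free_code ! x else 0)"
    and fr1: "\<forall>x. x \<notin> writes setup_prog \<longrightarrow> s1 x = ?s0 x"
    by (elim reachesE conjE exE) (rule that, assumption+)
  \<comment> \<open>This covers array 1 and all renamed working arrays, so \<open>p\<close> finds
    exactly its initial store.\<close>
  have zero1: "s1 x = (\<lambda>_. 0)" if "x \<notin> writes setup_prog" for x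
    using fr1[rule_format, OF that] graph_set_code_entries(5)[of x] that by auto
  have in1: "s1 (shift a) = init_store (graph_code free_verts (delete_verts G S)) a" for a
  proof (cases "a = 0")
    case True
    then show ?thesis
      using 1(5) by (auto simp: shift_def init_store_def free_code)
  next
    case False
    then have "s1 (shift a) = (\<lambda>_. 0)"
      by (intro zero1) (auto simp: shift_def)
    then show ?thesis using False by (auto simp: init_store_def)
  qed
  obtain s1' where p1: "exec p (init_store (graph_code free_verts (delete_verts G S))) tp s1'"
    and p2: "\<And>i. i < length (rep_code free_verts Is) \<Longrightarrow> s1' 1 i = rep_code free_verts Is ! i"
    using p by (auto simp: runs_def)
  obtain s2 where 2: "exec (rename shift p) s1 tp s2" "\<And>a. s2 (shift a) = s1' a"
    using exec_rename[OF p1 inj_shift in1] by blast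
  \<comment> \<open>\<open>shift\<close> omits the names 2 to 31, which therefore survive the run of
    the given program.\<close>
  have fr2: "s2 x = s1 x" if "2 \<le> x" "x < 32" for x
  proof (rule exec_frame[OF 2(1)])
    show "x \<notin> writes (rename shift p)"
      using writes_rename[of shift p] that by (auto simp: shift_def split: if_splits)
  qed
  have out2: "s2 1 x = rep_code free_verts Is ! x" if "x < length (rep_code free_verts Is)" for x
    using 2(2)[of 1] p2[OF that] by (simp add: shift_def)
  have ld2: "loaded s2" by (subst loaded_cong[of _ s1]) (use 1 fr2 in auto)
  have c2: "s2 vCount 0 = ?c" using 1 fr2 by auto
  have "reaches (mid_prog b) s2 18 (\<lambda>s. s vBase 0 = base \<and> s vGiven 0 = b)"
    by (rule reaches_straight)
      (use loadedD(1)[OF ld2] c2 rk_compl[of M n] in \<open>auto simp: mid_prog_def base_def\<close>)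
  from reaches_frame[OF this] obtain s3 t3 where 3: "exec (mid_prog b) s2 t3 s3" "t3 \<le> 18"
    "s3 vBase 0 = base" "s3 vGiven 0 = b" and fr3: "\<forall>x. x \<notin> writes (mid_prog b) \<longrightarrow> s3 x = s2 x"
    by (elim reachesE conjE exE) (rule that, assumption+)
  have ld3: "loaded s3" by (subst loaded_cong[of _ s2]) (use ld2 fr3 in auto)
  have zero3: "s3 aDig = (\<lambda>_. 0)" "s3 vDim = (\<lambda>_. 0)" "s3 vLen = (\<lambda>_. 0)"
    using zero1 fr2 fr3 by auto
  let ?ts = "n * n * 170 + (position base D Y * (D * base * 34 + 31 + n * n * (D * 340 + 170)) + 3)"
  have "reaches search_prog s3 ?ts (\<lambda>s. \<exists>d X. d \<le> D \<and> covers d X \<and> s vDim 0 = d \<and>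
    s vQ 0 = 1 + d * (n * n) \<and> rep_entries X d (s aRep))"
    by (rule search_spec[OF ld3 n _ _ _ _ Y]) (use zero3 3 in auto)
  from reaches_frame[OF this] obtain s4 t4 d X where 4: "exec search_prog s3 t4 s4" "t4 \<le> ?ts"
    "d \<le> D" "covers d X" "s4 vDim 0 = d" "s4 vQ 0 = 1 + d * (n * n)" "rep_entries X d (s4 aRep)"
    and fr4: "\<forall>x. x \<notin> writes search_prog \<longrightarrow> s4 x = s3 x"
    by (elim reachesE conjE exE) (rule that, assumption+)
  have ld4: "loaded s4" by (subst loaded_cong[of _ s3]) (use ld3 fr4 in auto)
  have s4: "s4 vGiven 0 = b" "s4 1 = s2 1" using 3 fr3 fr4 by auto
  let ?e = "\<lambda>i (u, v). of_bool ({vs ! u, vs ! v} \<in> edges (Is ! i)) :: nat"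
  have given: "s4 1 (1 + i * length free_pairs + t) = ?e i (free_pairs ! t)"
    if "i < b" "t < length free_pairs" for i t
  proof -
    have "1 + i * length free_pairs + t < length (rep_code free_verts Is)"
      using row_index_less[OF that] unfolding length_rep_code length_free_pairs rep(2) by simp
    then have "s4 1 (1 + i * length free_pairs + t) = rep_code free_verts Is ! (1 + i * length free_pairs + t)"
      using out2 s4 by simp
    also have "\<dots> = adj_matrix free_verts (Is ! i) ! t"
      unfolding length_free_pairs by (rule rep_code_nth) (use that rep(2) length_free_pairs in auto)
    also have "\<dots> = ?e i (free_pairs ! t)"
      using that by (simp add: adj_matrix_free_verts)
    finally show ?thesis .
  qed
  have "reaches expand_prog s4 (n * n * (b * 95 + 12))
    (\<lambda>s. s vQ 0 = 1 + d * (n * n) + b * (n * n) \<and> (\<forall>x<1 + d * (n * n). s aRep x = s4 aRep x) \<and>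
      (\<forall>i<b. \<forall>u<n. \<forall>v<n. s aRep (1 + d * (n * n) + i * (n * n) + (u * n + v)) =
        (if M u \<or> M v then of_bool (u \<noteq> v) else ?e i (u, v))))"
    by (rule expand_spec[where e = ?e, OF ld4 n 4(6) s4(1)]) (rule given)
  from reaches_frame[OF this]
  obtain s5 t5 where 5: "exec expand_prog s4 t5 s5" "t5 \<le> n * n * (b * 95 + 12)"
    "s5 vQ 0 = 1 + d * (n * n) + b * (n * n)" "\<forall>x<1 + d * (n * n). s5 aRep x = s4 aRep x"
    "\<forall>i<b. \<forall>u<n. \<forall>v<n. s5 aRep (1 + d * (n * n) + i * (n * n) + (u * n + v)) =
        (if M u \<or> M v then of_bool (u \<noteq> v) else ?e i (u, v))"
    and fr5: "\<forall>x. x \<notin> writes expand_prog \<longrightarrow> s5 x = s4 x"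
    by (elim reachesE conjE exE) (rule that, assumption+)
  let ?q = "1 + (d + b) * (n * n)"
  have "reaches output_prog s5 (?q * 18 + 16)
    (\<lambda>s. s 1 0 = d + b \<and> (\<forall>x. 0 < x \<and> x < ?q \<longrightarrow> s 1 x = s5 aRep x))"
    by (rule output_spec) (use 5 4 s4 fr5 in \<open>auto simp: algebra_simps\<close>)
  then obtain s6 t6 where 6: "exec output_prog s5 t6 s6" "t6 \<le> ?q * 18 + 16" "s6 1 0 = d + b"
    "\<forall>x. 0 < x \<and> x < ?q \<longrightarrow> s6 1 x = s5 aRep x"
    by (elim reachesE conjE exE) (rule that, assumption+)
  define \<B> where "\<B> = map (hull_graph X) [0..<d] @ map (extend_graph (verts G) S) Is"
  have len: "length \<B> = d + b" by (simp add: \<B>_def rep(2))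
  have box: "box_representation G \<B>"
    unfolding \<B>_def by (rule box_representation_combined[OF 4(4) rep(1)])
  \<comment> \<open>Matrices below \<open>d\<close> come from the search and are preserved by the
    expansion, which appends the other \<open>b\<close> behind them.\<close>
  have mat: "s5 aRep (1 + i * (n * n) + (u * n + v)) = of_bool ({vs ! u, vs ! v} \<in> edges (\<B> ! i))"
    if i: "i < d + b" and uv: "u < n" "v < n" for i u v
  proof (cases "i < d")
    case True
    have "1 + i * (n * n) + (u * n + v) < 1 + d * (n * n)"
      using row_index_less[OF True row_index_less[OF uv]] by simp
    then have "s5 aRep (1 + i * (n * n) + (u * n + v)) = of_bool (u \<noteq> v \<and> meets X i u v)"
      using 5(4) 4(7) True uv by (simp add: rep_entries_def)
    then show ?thesis
      using True hull_graph_edge_iff[OF uv, of X i] by (simp add: \<B>_def nth_append)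
  next
    case False
    then obtain j where j: "i = d + j" "j < b" using i by (metis le_Suc_ex not_less nat_add_left_cancel_less)
    have "1 + i * (n * n) + (u * n + v) = 1 + d * (n * n) + j * (n * n) + (u * n + v)"
      by (simp add: j(1) algebra_simps)
    then have "s5 aRep (1 + i * (n * n) + (u * n + v)) =
      (if M u \<or> M v then of_bool (u \<noteq> v) else ?e j (u, v))"
      using 5(5)[rule_format, OF j(2) uv] by simp
    moreover have "Is ! j \<in> set Is" using j rep(2) by simp
    ultimately show ?thesis
      using extend_graph_edge_iff[OF rep(1) _ uv] j rep(2) by (simp add: \<B>_def nth_append)
  qed
  have "s6 1 x = rep_code vs \<B> ! x" if x: "x < length (rep_code vs \<B>)" for x
  proof (cases "x = 0")
    case True
    then show ?thesis using 6 by (simp add: rep_code_0 len)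
  next
    case False
    then obtain y where y: "x = 1 + y" by (cases x) auto
    have y_less: "y < (d + b) * (n * n)" using x by (simp add: y length_rep_code len n_def)
    have nn: "0 < n * n" using n by simp
    \<comment> \<open>Division by \<open>n * n\<close> splits a position into graph and entry,
      division by \<open>n\<close> splits the entry into row and column.\<close>
    define i t where "i = y div (n * n)" and "t = y mod (n * n)"
    define u v where "u = t div n" and "v = t mod n"
    have i: "i < d + b" using y_less nn by (simp add: i_def less_mult_imp_div_less)
    have t: "t < n * n" using nn by (simp add: t_def)
    have uv: "u < n" "v < n" using t n by (auto simp: u_def v_def less_mult_imp_div_less)
    have y_eq: "y = i * (n * n) + t" unfolding i_def t_def by (rule div_mult_mod_eq[symmetric])
    have t_eq: "t = u * n + v" unfolding u_def v_def by (rule div_mult_mod_eq[symmetric])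
    have "s6 1 x = s5 aRep (1 + i * (n * n) + (u * n + v))"
      using 6(4)[rule_format, of x] y_less by (simp add: y y_eq t_eq)
    also have "\<dots> = of_bool ({vs ! u, vs ! v} \<in> edges (\<B> ! i))"
      by (rule mat[OF i uv])
    also have "\<dots> = adj_matrix vs (\<B> ! i) ! t"
      using adj_matrix_nth[of u vs v] uv by (simp add: t_eq n_def)
    also have "\<dots> = rep_code vs \<B> ! (1 + i * (length vs * length vs) + t)"
      by (rule rep_code_nth[symmetric]) (use i t in \<open>auto simp: len n_def\<close>)
    finally show ?thesis by (simp add: y y_eq n_def)
  qed
  moreover have "exec (full_prog b p) ?s0 (t1 + (tp + (t3 + (t4 + (t5 + t6))))) s6"
    unfolding full_prog_def by (intro exec.Seq) (fact 1(1) 2(1) 3(1) 4(1) 5(1) 6(1))+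
  ultimately have "runs (full_prog b p) (graph_set_code vs G S) (t1 + (tp + (t3 + (t4 + (t5 + t6))))) (rep_code vs \<B>)"
    unfolding runs_def by blast
  moreover have "t1 + (tp + (t3 + (t4 + (t5 + t6)))) \<le> n * n * 200 + (tp + (18 + (?ts +
      (n * n * (b * 95 + 12) + ((1 + (D + b) * (n * n)) * 18 + 16)))))"
  proof -
    have "?q * 18 + 16 \<le> (1 + (D + b) * (n * n)) * 18 + 16" using 4(3) by simp
    with 6(2) have "t6 \<le> (1 + (D + b) * (n * n)) * 18 + 16" by (rule order_trans)
    then show ?thesis by (intro add_mono 1(2) 3(2) 4(2) 5(2) order_refl)
  qed
  ultimately show ?thesis
    using box len 4(3) by (intro exI[of _ \<B>] exI conjI) auto
qed

end

text \<open>The 3 in the exponent is one factor \<open>B\<close> for summing over dimensions and two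
  for the cost of a candidate. The search accounts for 600 of the constant, the other stages for 500
  plus the multiple of \<open>b\<close>.\<close>

lemma time_bound:
  fixes n s b D B P :: nat
  assumes n: "1 \<le> n" and D: "D \<le> s" and B: "B = 2 * s + 1"
    and P: "P \<le> (\<Sum>e<Suc D. B ^ (e * B))"
  shows "n * n * 200 + (18 + ((n * n * 170 + (P * (D * B * 34 + 31 + n * n * (D * 340 + 170)) + 3)) +
      (n * n * (b * 95 + 12) + ((1 + (D + b) * (n * n)) * 18 + 16))))
    \<le> n * n * ((1100 + 113 * b) * B ^ (s * B + 3))"
proof -
  define N where "N = n * n"
  define E where "E = B ^ (s * B + 3)"
  have N: "1 \<le> N" using n by (simp add: N_def)
  have B1: "1 \<le> B" "s + 1 \<le> B" "s \<le> B" using B by auto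
  have BB: "1 \<le> B * B" "B \<le> B * B" using B1 by auto
  note P
  \<comment> \<open>Every summand is bounded by the largest possible one, and there are at most s+1,
    hence at most \<open>B\<close>, of them.\<close>
  also have "(\<Sum>e<Suc D. B ^ (e * B)) \<le> (\<Sum>e<Suc D. B ^ (s * B))"
    using D B1 by (intro sum_mono power_increasing) auto
  also have "\<dots> = Suc D * B ^ (s * B)" by simp
  also have "\<dots> \<le> B * B ^ (s * B)" using D B1 by (intro mult_right_mono) auto
  finally have P1: "P \<le> B * B ^ (s * B)" .
  have "D * B * 34 + 31 + N * (D * 340 + 170) \<le> N * (600 * (B * B))"
  proof -
    have "D \<le> B" using D B1 by simp
    then have DB: "D * B \<le> B * B" "D \<le> B * B" using BB by (auto intro: order_trans)
    have "D * B * 34 + 31 \<le> 65 * (B * B)" using DB BB by linarith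
    also have "\<dots> \<le> N * (65 * (B * B))" using N by simp
    finally have 1: "D * B * 34 + 31 \<le> N * (65 * (B * B))" .
    have "D * 340 + 170 \<le> 510 * (B * B)" using DB BB by linarith
    then have 2: "N * (D * 340 + 170) \<le> N * (510 * (B * B))" by (rule mult_left_mono) simp
    have "N * (65 * (B * B)) + N * (510 * (B * B)) \<le> N * (600 * (B * B))"
      by (simp add: algebra_simps)
    with 1 2 show ?thesis by linarith
  qed
  then have "P * (D * B * 34 + 31 + N * (D * 340 + 170)) \<le> (B * B ^ (s * B)) * (N * (600 * (B * B)))"
    by (intro mult_mono P1) auto
  also have "\<dots> = N * (600 * E)" by (simp add: E_def power_add power3_eq_cube algebra_simps)
  finally have search: "P * (D * B * 34 + 31 + N * (D * 340 + 170)) \<le> N * (600 * E)" .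
  have "B ^ 1 \<le> E" unfolding E_def using B1 by (intro power_increasing) auto
  then have E: "1 \<le> E" "s \<le> E" using B1 by auto
  have DbE: "(18 * D + 113 * b + 450) \<le> (500 + 113 * b) * E"
  proof -
    have "113 * b \<le> 113 * b * E" using E by simp
    then have "18 * D + 113 * b + 450 \<le> 500 * E + 113 * b * E" using D E by linarith
    then show ?thesis by (simp add: algebra_simps)
  qed
  have "N * 200 + (18 + ((N * 170 + 3) + (N * (b * 95 + 12) + ((1 + (D + b) * N) * 18 + 16))))
    \<le> N * (18 * D + 113 * b + 450)"
    using N by (simp add: algebra_simps)
  also have "\<dots> \<le> N * ((500 + 113 * b) * E)" using DbE by (rule mult_left_mono) simp
  finally have rest: "N * 200 + (18 + ((N * 170 + 3) + (N * (b * 95 + 12) + ((1 + (D + b) * N) * 18 + 16))))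
    \<le> N * ((500 + 113 * b) * E)" .
  have "N * (600 * E) + N * ((500 + 113 * b) * E) = N * ((1100 + 113 * b) * E)"
    by (simp add: algebra_simps)
  with search rest show ?thesis unfolding N_def[symmetric] E_def[symmetric] by linarith
qed

theorem theorem1:
  fixes b :: nat and F :: "'a sgraph set" and T :: "nat \<Rightarrow> nat" and p :: prog
  assumes "\<forall>G' \<in> F. simple_graph G'"
    and "\<forall>G' \<in> F. boxicity G' \<le> b"
    and "computes_box_reps p F b T"
  shows "\<exists>q :: prog. \<exists>g :: nat \<Rightarrow> real.
    g \<in> O(\<lambda>k. (real k)\<^sup>2 * log 2 (real k)) \<and>
    (\<forall>n k G S vs. G \<in> plus_kv F k \<and> card (verts G) = n \<and> n \<ge> 1 \<and>
        modulator F k G S \<and> enumerates vs (verts G) \<longrightarrow>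
      (\<exists>\<B> t. box_representation G \<B> \<and>
         real (length \<B>) \<le> (if boxicity G = 0 then real b
            else real (boxicity G) * (2 + real b / real (boxicity G))) \<and>
         runs q (graph_set_code vs G S) t (rep_code vs \<B>) \<and>
         real t \<le> real (T (n - card S)) + (real n)\<^sup>2 * 2 powr g k))"
proof -
  \<comment> \<open>The binary logarithm of the bound in \<open>time_bound\<close> with
    \<open>k\<close> for the modulator size. As \<open>b\<close> is fixed, its contribution is a
    constant.\<close>
  define g :: "nat \<Rightarrow> real" where
    "g k = log 2 (1100 + 113 * b) + (real k * (2 * real k + 1) + 3) * log 2 (2 * real k + 1)" for k
  have g_O: "g \<in> O(\<lambda>k. (real k)\<^sup>2 * log 2 (real k))"
    unfolding g_def by real_asymp
  have g_powr: "2 powr g k = real ((1100 + 113 * b) * (2 * k + 1) ^ (k * (2 * k + 1) + 3))" for k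
  proof -
    have "2 powr g k = (1100 + 113 * b) * (2 * real k + 1) powr (real k * (2 * real k + 1) + 3)"
      by (simp add: g_def powr_add powr_powr[symmetric] mult.commute[of _ "log 2 _"])
    also have "(2 * real k + 1) powr (real k * (2 * real k + 1) + 3) =
      (2 * real k + 1) powr real (k * (2 * k + 1) + 3)"
      by (simp add: algebra_simps)
    also have "\<dots> = (2 * real k + 1) ^ (k * (2 * k + 1) + 3)"
      by (rule powr_realpow) simp
    finally show ?thesis by (simp add: algebra_simps)
  qed
  have main: "\<exists>\<B> t. box_representation G \<B> \<and>
         real (length \<B>) \<le> (if boxicity G = 0 then real b
            else real (boxicity G) * (2 + real b / real (boxicity G))) \<and>
         runs (full_prog b p) (graph_set_code vs G S) t (rep_code vs \<B>) \<and>
         real t \<le> real (T (n - card S)) + (real n)\<^sup>2 * 2 powr g k"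
    if G: "G \<in> plus_kv F k" and card: "card (verts G) = n" "n \<ge> 1"
      and S: "modulator F k G S" and vs: "enumerates vs (verts G)" for n k G S vs
  proof -
    have simple: "simple_graph G" using G by (simp add: plus_kv_def)
    have S': "S \<subseteq> verts G" "card S \<le> k" "delete_verts G S \<in> F" using S by (auto simp: modulator_def)
    interpret enumerated_graph G S vs by unfold_locales (fact simple vs)+
    have len: "enumerated_graph.n vs = n"
      using vs card distinct_card[of vs] by (auto simp: n_def enumerates_def)
    obtain Is tp where Is: "box_representation (delete_verts G S) Is" "length Is = b"
      "runs p (graph_code free_verts (delete_verts G S)) tp (rep_code free_verts Is)"
      "tp \<le> T (card (verts (delete_verts G S)))"
      using assms(3) S'(3) enumerates_free_verts unfolding computes_box_reps_def by blast
    have "finite (verts G)" using simple by (simp add: simple_graph_def)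
    then have cardS: "card (verts (delete_verts G S)) = n - card S"
      using S'(1) card by (simp add: delete_verts_def card_Diff_subset finite_subset)
    obtain D Y where D: "D \<le> 2 * boxicity G" "D \<le> rk M n" and
      Y: "\<forall>j. Y j < base" "\<forall>j \<ge> D * base. Y j = 0" "covers D Y"
      using exists_small_cover[OF Is(1)] len by auto
    obtain \<B> t where B: "box_representation G \<B>" "length \<B> \<le> D + b"
      "runs (full_prog b p) (graph_set_code vs G S) t (rep_code vs \<B>)"
      "t \<le> n * n * 200 + (tp + (18 + ((n * n * 170 +
        (position base D Y * (D * base * 34 + 31 + n * n * (D * 340 + 170)) + 3)) +
        (n * n * (b * 95 + 12) + ((1 + (D + b) * (n * n)) * 18 + 16)))))"
      using full_prog_spec[OF _ Is(1,2,3), of Y D] Y card(2) unfolding len by blast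
    let ?s = "rk M n"
    have s: "?s \<le> k" using rk_card[OF S'(1)] S'(2) len by simp
    have base: "base = 2 * ?s + 1" by (subst base_def) (simp add: len)
    have "n * n * 200 + (18 + ((n * n * 170 +
        (position base D Y * (D * base * 34 + 31 + n * n * (D * 340 + 170)) + 3)) +
        (n * n * (b * 95 + 12) + ((1 + (D + b) * (n * n)) * 18 + 16))))
      \<le> n * n * ((1100 + 113 * b) * base ^ (?s * base + 3))"
      by (rule time_bound[OF card(2) D(2) base])
        (use position_less[of Y base D] Y(1) in \<open>auto intro: less_imp_le\<close>)
    also have "\<dots> \<le> n * n * ((1100 + 113 * b) * (2 * k + 1) ^ (k * (2 * k + 1) + 3))"
    proof -
      \<comment> \<open>The search depends on the actual size of \<open>S\<close>, for which
        \<open>k\<close> is only an upper bound; base and exponent both grow with it.\<close>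
      have "base ^ (?s * base + 3) \<le> (2 * k + 1) ^ (?s * base + 3)"
        using s by (intro power_mono) (auto simp: base)
      also have "\<dots> \<le> (2 * k + 1) ^ (k * (2 * k + 1) + 3)"
        using s by (intro power_increasing add_mono mult_mono) (auto simp: base)
      finally show ?thesis by (intro mult_left_mono) auto
    qed
    finally have "t \<le> T (n - card S) + n * n * ((1100 + 113 * b) * (2 * k + 1) ^ (k * (2 * k + 1) + 3))"
      using B(4) Is(4) cardS by simp
    then have "real t \<le> real (T (n - card S) + n * n * ((1100 + 113 * b) * (2 * k + 1) ^ (k * (2 * k + 1) + 3)))"
      by (rule of_nat_mono)
    then have time: "real t \<le> real (T (n - card S)) + (real n)\<^sup>2 * 2 powr g k"
      unfolding g_powr by (simp add: power2_eq_square)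
    \<comment> \<open>This covers boxicity 0 as well: there \<open>D\<close> is 0, and only the
      \<open>b\<close> extended graphs are counted.\<close>
    have "real (length \<B>) \<le> real (2 * boxicity G + b)"
      using B(2) D(1) by (intro of_nat_mono) simp
    moreover have "real (boxicity G) * (2 + real b / real (boxicity G)) = real (2 * boxicity G + b)"
      if "boxicity G \<noteq> 0"
      using that by (simp add: field_simps)
    ultimately have "real (length \<B>) \<le> (if boxicity G = 0 then real b
            else real (boxicity G) * (2 + real b / real (boxicity G)))"
      by auto
    then show ?thesis using B(1,3) time by blast
  qed
  show ?thesis
    by (intro exI[of _ "full_prog b p"] exI[of _ g] conjI g_O) (use main in blast)
qed

end
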